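(* Let $t$ be a positive even integer and let $\rho_1,\rho_2$ be two functions defined on $\mathbb{N}$. Let $f_t$ and $g_t$ be the formal power series $$f_{t}(q):=\sum_{\nu\in\mathcal{P}}q^{|\nu|}\prod_{h\in\mathcal{H}(\nu)}\rho_1(th)^2,\qquad g_{t}(q):=\sum_{\nu\in\mathcal{P}}q^{|\nu|}\prod_{h\in\mathcal{H}(\nu)}\rho_1(th)^2\sum_{h\in\mathcal{H}(\nu)}\rho_2(th).$$ Then $$\sum_{\lambda\in \mathcal{SC}}q^{|\lambda|}x^{|\mathcal{H}_{t}(\lambda)|}b^{\mathrm{BG}(\lambda)}\prod_{h\in\mathcal{H}_{t}(\lambda)}\rho_1(h)\sum_{h\in\mathcal{H}_{t}(\lambda)}\rho_2(h)=t\left(f_{t}(x^2q^{2t})\right)^{t/2-1}g_{t}(x^2q^{2t})\left(q^{2t};q^{2t}\right)_{\infty}^{t/2}\left(-bq;q^4\right)_{\infty}\left(-q^3/b;q^4\right)_{\infty}.$$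
   Context: A partition is a finite nonincreasing sequence $\lambda=(\lambda_1,\dots,\lambda_\ell)$ of positive integers (the empty partition is allowed), $|\lambda|$ is the sum of its parts, and $\mathcal{P}$ is the set of all partitions. A partition is identified with its Ferrers diagram, the set of boxes $(i,j)$ (row $i$, column $j$) with $1\le j\le\lambda_i$. The conjugate $\lambda'$ is given by $\lambda'_j=\#\{i:\lambda_i\ge j\}$; $\mathcal{SC}$ is the set of self-conjugate partitions ($\lambda=\lambda'$). The hook-length of a box $(i,j)$ is $\lambda_i-j+\lambda'_j-i+1$; $\mathcal{H}(\lambda)$ is the multiset of all hook-lengths of $\lambda$, and $\mathcal{H}_t(\lambda)$ is the sub-multiset of hook-lengths divisible by $t$ (cardinality, products and sums are taken with multiplicity; empty products are $1$, empty sums are $0$). The BG-rank is $\mathrm{BG}(\lambda)=\sum_{(i,j)\in\lambda}(-1)^{i+j}$. Also $(a;q)_\infty=\prod_{j\ge0}(1-aq^j)$. The functions $\rho_1,\rho_2$ take complex values. The identity is one of formal power series in $q$ whose coefficients are polynomials in $x,b,b^{-1}$. *)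

theory Defs
  imports "HOL-Analysis.Analysis" "HOL-Computational_Algebra.Computational_Algebra"
begin

section \<open>Partitions and hook lengths\<close>

definition partitions :: "nat list set" where
  "partitions = {\<mu>. sorted_wrt (\<ge>) \<mu> \<and> (\<forall>p\<in>set \<mu>. 0 < p)}"

text \<open>Parts are indexed from 1, and \<open>part \<mu> i = 0\<close> beyond the length of \<open>\<mu>\<close>.\<close>

definition part :: "nat list \<Rightarrow> nat \<Rightarrow> nat" where
  "part \<mu> i = (if 1 \<le> i \<and> i \<le> length \<mu> then \<mu> ! (i - 1) else 0)"

definition diagram :: "nat list \<Rightarrow> (nat \<times> nat) set" where
  "diagram \<mu> = {(i, j). 1 \<le> i \<and> i \<le> length \<mu> \<and> 1 \<le> j \<and> j \<le> part \<mu> i}"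

definition conjugate :: "nat list \<Rightarrow> nat list" where
  "conjugate \<mu> = map (\<lambda>j. card {i. 1 \<le> i \<and> i \<le> length \<mu> \<and> j \<le> part \<mu> i}) [1..<Suc (part \<mu> 1)]"

definition self_conjugate_partitions :: "nat list set" where
  "self_conjugate_partitions = {\<mu> \<in> partitions. conjugate \<mu> = \<mu>}"

text \<open>Both subtractions on \<open>nat\<close> are exact for a box \<open>(i, j)\<close> of the diagram.\<close>

definition hook_length :: "nat list \<Rightarrow> nat \<times> nat \<Rightarrow> nat" where
  "hook_length \<mu> = (\<lambda>(i, j). (part \<mu> i - j) + (part (conjugate \<mu>) j - i) + 1)"

definition hooks :: "nat list \<Rightarrow> nat multiset" where
  "hooks \<mu> = image_mset (hook_length \<mu>) (mset_set (diagram \<mu>))"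

definition hooks_div :: "nat \<Rightarrow> nat list \<Rightarrow> nat multiset" where
  "hooks_div t \<mu> = filter_mset (\<lambda>h. t dvd h) (hooks \<mu>)"

definition BG_rank :: "nat list \<Rightarrow> int" where
  "BG_rank \<mu> = (\<Sum>(i, j)\<in>diagram \<mu>. (-1) ^ (i + j))"


section \<open>Formal power series\<close>

text \<open>
  The coefficient ring \<open>\<complex>[x, b, 1/b]\<close> is embedded into the ring \<open>\<complex>[x]((b))\<close> of Laurent series
  in \<open>b\<close> over \<open>\<complex>[x]\<close>; power series in \<open>q\<close> over it have \<open>q = fps_X\<close>.
\<close>

type_synonym series = "complex poly fls fps"

definition coeff_of_complex :: "complex \<Rightarrow> complex poly fls" where
  "coeff_of_complex c = fls_const [:c:]"

definition var_q :: series where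
  "var_q = fps_X"

definition var_x :: series where
  "var_x = fps_const (fls_const [:0, 1:])"

definition b_powi :: "int \<Rightarrow> series" where
  "b_powi n = fps_const (fls_X_intpow n)"

text \<open>\<open>subst_series F z\<close> is \<open>F(z)\<close>, for \<open>z\<close> with zero constant term.\<close>

definition subst_series :: "complex fps \<Rightarrow> series \<Rightarrow> series" where
  "subst_series F z = fps_compose (Abs_fps (\<lambda>n. coeff_of_complex (fps_nth F n))) z"

text \<open>
  Infinite sums and products of formal power series, here and below, are taken in the library's
  metric on \<open>fps\<close>, whose convergence is stabilisation of each coefficient.
\<close>

definition qpochhammer_inf :: "'a::comm_ring_1 fps \<Rightarrow> 'a fps \<Rightarrow> 'a fps" where
  "qpochhammer_inf a q = prodinf (\<lambda>j. 1 - a * q ^ j)"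

definition f_series :: "nat \<Rightarrow> (nat \<Rightarrow> complex) \<Rightarrow> complex fps" where
  "f_series t \<rho>\<^sub>1 =
     (\<Sum>\<^sub>\<infinity>\<nu>\<in>partitions. fps_X ^ sum_list \<nu> * fps_const (\<Prod>h\<in>#hooks \<nu>. (\<rho>\<^sub>1 (t * h))\<^sup>2))"

definition g_series :: "nat \<Rightarrow> (nat \<Rightarrow> complex) \<Rightarrow> (nat \<Rightarrow> complex) \<Rightarrow> complex fps" where
  "g_series t \<rho>\<^sub>1 \<rho>\<^sub>2 =
     (\<Sum>\<^sub>\<infinity>\<nu>\<in>partitions. fps_X ^ sum_list \<nu> *
        fps_const ((\<Prod>h\<in>#hooks \<nu>. (\<rho>\<^sub>1 (t * h))\<^sup>2) * (\<Sum>h\<in>#hooks \<nu>. \<rho>\<^sub>2 (t * h))))"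

end

theory Submission
  imports Defs
begin

text \<open>
  Encode a partition by the set \<open>{\<mu>\<^sub>i - i}\<close> of its beads. Hooks become inversions (a bead above a
  hole), conjugation becomes reflection followed by complementation, and the size and the BG-rank
  become sums of a weight over the beads. Splitting a self-conjugate bead set into residue classes
  modulo \<open>t = 2m\<close> leaves \<open>m\<close> arbitrary bead sets: the hooks divisible by \<open>t\<close> are the hooks of
  these sets, each taken twice and scaled by \<open>t\<close>, and each set is a charge together with a partition.
  So the left-hand side is a product of \<open>m\<close> charge sums times \<open>t f^(m - 1) g\<close>. The product of the charge
  sums does not depend on \<open>\<rho>\<^sub>1\<close>, \<open>\<rho>\<^sub>2\<close> and \<open>x\<close>, so it can be read off from the case of trivial weights,
  where a self-conjugate partition is just the finite set of its nonnegative beads and Euler's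
  product counts all partitions; the Jacobi triple product is not needed.
\<close>

section \<open>Locally finite sums of formal power series\<close>

text \<open>Evenness of \<open>t\<close> is what leaves the pieces free. The reflection y -> -1 - y
  carries residue class r to class t - 1 - r, so for t = 2m no class is its own mirror image: the
  classes below m can be chosen at will, and the others are their duals. Mirror classes have
  opposite charges, so the vanishing total charge of a partition does not tie the charges of the m
  chosen classes together. The doubling of hooks accounts for the squares of
  \<open>\<rho>\<^sub>1\<close> and for x^2. The sum over \<open>\<rho>\<^sub>2\<close> is additive
  rather than multiplicative; it is expanded over the class that carries the hook. The marked class
  then yields g and each of the m - 1 others yields f. All sums are infinite and taken in the metric
  of \<open>fps\<close>. An identity between them is proved modulo X^(n+1) for every n, by
  exhibiting one finite expression to which both sides are congruent.\<close>

definition eq_upto :: "nat \<Rightarrow> 'a fps \<Rightarrow> 'a fps \<Rightarrow> bool" where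
  "eq_upto n f g \<longleftrightarrow> (\<forall>k\<le>n. fps_nth f k = fps_nth g k)"

lemma eq_upto_refl [simp]: "eq_upto n f f"
  by (simp add: eq_upto_def)

lemma eq_upto_join: "eq_upto n f h \<Longrightarrow> eq_upto n g h \<Longrightarrow> eq_upto n f g"
  by (simp add: eq_upto_def)

lemma eq_upto_mono: "eq_upto n f g \<Longrightarrow> m \<le> n \<Longrightarrow> eq_upto m f g"
  by (simp add: eq_upto_def)

lemma fps_eq_upto: "(\<And>n. eq_upto n f g) \<Longrightarrow> f = g"
  by (auto simp: fps_eq_iff eq_upto_def)

lemma eq_upto_mult:
  fixes f g :: "'a::semiring_1 fps"
  assumes "eq_upto n f f'" "eq_upto n g g'"
  shows "eq_upto n (f * g) (f' * g')"
  using assms by (auto simp: eq_upto_def fps_mult_nth intro!: sum.cong)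

lemma eq_upto_sum:
  fixes f g :: "'i \<Rightarrow> 'a::comm_monoid_add fps"
  assumes "\<And>r. r \<in> R \<Longrightarrow> eq_upto n (f r) (g r)"
  shows "eq_upto n (sum f R) (sum g R)"
  using assms by (induction R rule: infinite_finite_induct) (auto simp: eq_upto_def)

lemma eq_upto_prod:
  fixes f g :: "'i \<Rightarrow> 'a::comm_semiring_1 fps"
  assumes "\<And>r. r \<in> R \<Longrightarrow> eq_upto n (f r) (g r)"
  shows "eq_upto n (prod f R) (prod g R)"
  using assms by (induction R rule: infinite_finite_induct) (auto intro: eq_upto_mult)

text \<open>Multiplication never lowers the order of a power series, so one factor that vanishes
  through degree n suffices. This makes products of sums negligible outside a finite box of
  indices.\<close>

lemma eq_upto_prod_0:
  fixes f :: "'i \<Rightarrow> 'a::comm_semiring_1 fps"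
  assumes "finite R" "r \<in> R" "eq_upto n (f r) 0"
  shows "eq_upto n (prod f R) 0"
proof -
  have "eq_upto n (f r * prod f (R - {r})) (0 * prod f (R - {r}))"
    by (intro eq_upto_mult assms eq_upto_refl)
  then show ?thesis
    using assms by (simp add: prod.remove)
qed

text \<open>The notion of summability used throughout: modulo each X^(n+1) only finitely many terms
  survive, so neither order nor grouping matters.\<close>

definition locally_finite :: "('i \<Rightarrow> 'a::zero fps) \<Rightarrow> 'i set \<Rightarrow> bool" where
  "locally_finite f I \<longleftrightarrow> (\<forall>n. finite {i \<in> I. \<not> eq_upto n (f i) 0})"

lemma locally_finiteI:
  assumes "\<And>n. finite {i \<in> I. fps_nth (f i) n \<noteq> 0}"
  shows "locally_finite f I"
  unfolding locally_finite_def
proof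
  fix n
  have "{i \<in> I. \<not> eq_upto n (f i) 0} = (\<Union>k\<le>n. {i \<in> I. fps_nth (f i) k \<noteq> 0})"
    by (auto simp: eq_upto_def)
  then show "finite {i \<in> I. \<not> eq_upto n (f i) 0}"
    using assms by simp
qed

lemma locally_finite_support:
  "locally_finite f I \<Longrightarrow> finite {i \<in> I. fps_nth (f i) n \<noteq> 0}"
  unfolding locally_finite_def
  by (rule finite_subset[of _ "{i \<in> I. \<not> eq_upto n (f i) 0}"]) (auto simp: eq_upto_def)

lemma locally_finite_subdegree:
  fixes d :: "'i \<Rightarrow> nat"
  assumes "\<And>n. finite {i \<in> I. d i \<le> n}" "\<And>i n. i \<in> I \<Longrightarrow> n < d i \<Longrightarrow> fps_nth (f i) n = 0"
  shows "locally_finite f I"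
proof (rule locally_finiteI)
  fix n
  show "finite {i \<in> I. fps_nth (f i) n \<noteq> 0}"
    by (rule finite_subset[OF _ assms(1)[of n]]) (use assms(2) not_less in blast)
qed

text \<open>Limits in \<open>fps\<close> are coefficientwise. The n-th coefficient of a partial sum
  is final once the index set contains every term whose n-th coefficient is nonzero.\<close>

lemma has_sum_locally_finite:
  fixes f :: "'i \<Rightarrow> 'a::ab_group_add fps"
  assumes "locally_finite f I"
  shows "(f has_sum Abs_fps (\<lambda>n. \<Sum>i\<in>{i \<in> I. fps_nth (f i) n \<noteq> 0}. fps_nth (f i) n)) I"
  unfolding has_sum_def
proof (rule tendsto_fpsI)
  fix n
  have fin: "finite {i \<in> I. fps_nth (f i) n \<noteq> 0}" (is "finite ?S")
    using assms by (rule locally_finite_support)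
  have "fps_nth (sum f F) n = (\<Sum>i\<in>?S. fps_nth (f i) n)" if "finite F" "?S \<subseteq> F" "F \<subseteq> I" for F
    unfolding fps_sum_nth using that by (intro sum.mono_neutral_right) auto
  then show "\<forall>\<^sub>F F in finite_subsets_at_top I. fps_nth (sum f F) n =
      fps_nth (Abs_fps (\<lambda>n. \<Sum>i\<in>{i \<in> I. fps_nth (f i) n \<noteq> 0}. fps_nth (f i) n)) n"
    unfolding eventually_finite_subsets_at_top
    by (intro exI[of _ ?S]) (use fin in auto)
qed

text \<open>\<open>F\<close> may be larger than the set of surviving terms, so several sums can be
  truncated at one common set.\<close>

lemma infsum_eq_upto:
  fixes f :: "'i \<Rightarrow> 'a::ab_group_add fps"
  assumes "locally_finite f I" "finite F" "F \<subseteq> I" "\<And>i. i \<in> I - F \<Longrightarrow> eq_upto n (f i) 0"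
  shows "eq_upto n (infsum f I) (sum f F)"
  unfolding eq_upto_def infsumI[OF has_sum_locally_finite[OF assms(1)]]
proof (intro allI impI)
  fix k assume "k \<le> n"
  then have "fps_nth (f i) k = 0" if "i \<in> I - F" for i
    using assms(4)[OF that] by (auto simp: eq_upto_def)
  then have "(\<Sum>i\<in>{i \<in> I. fps_nth (f i) k \<noteq> 0}. fps_nth (f i) k) = (\<Sum>i\<in>F. fps_nth (f i) k)"
    using assms by (intro sum.mono_neutral_left) auto
  then show "fps_nth (Abs_fps (\<lambda>n. \<Sum>i\<in>{i \<in> I. fps_nth (f i) n \<noteq> 0}. fps_nth (f i) n)) k =
      fps_nth (sum f F) k"
    by (simp add: fps_sum_nth)
qed

text \<open>Outside the finite box \<open>PiE R (F n)\<close> some coordinate selects a factor that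
  vanishes through degree n, and with it the product. On the box this is the finite distributive
  law.\<close>

lemma prod_infsum_PiE:
  fixes f :: "'r \<Rightarrow> 'i \<Rightarrow> 'a::comm_ring_1 fps"
  assumes R: "finite R" and lf: "\<And>r. r \<in> R \<Longrightarrow> locally_finite (f r) (I r)"
  shows "locally_finite (\<lambda>x. \<Prod>r\<in>R. f r (x r)) (PiE R I)"
    and "(\<Sum>\<^sub>\<infinity>x\<in>PiE R I. \<Prod>r\<in>R. f r (x r)) = (\<Prod>r\<in>R. infsum (f r) (I r))"
proof -
  define F where "F n r = {i \<in> I r. \<not> eq_upto n (f r i) 0}" for n r
  have fin: "finite (PiE R (F n))" for n
    using lf by (intro finite_PiE R) (auto simp: F_def locally_finite_def)
  have outside: "eq_upto n (\<Prod>r\<in>R. f r (x r)) 0" if x: "x \<in> PiE R I - PiE R (F n)" for x n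
  proof -
    from x obtain r where "r \<in> R" "x r \<in> I r - F n r"
      by (auto simp: PiE_iff)
    then show ?thesis
      by (intro eq_upto_prod_0[of R r]) (auto simp: F_def R)
  qed
  show lf': "locally_finite (\<lambda>x. \<Prod>r\<in>R. f r (x r)) (PiE R I)"
    unfolding locally_finite_def using outside by (blast intro: finite_subset[OF _ fin])
  show "(\<Sum>\<^sub>\<infinity>x\<in>PiE R I. \<Prod>r\<in>R. f r (x r)) = (\<Prod>r\<in>R. infsum (f r) (I r))"
  proof (rule fps_eq_upto)
    fix n
    have "eq_upto n (\<Sum>\<^sub>\<infinity>x\<in>PiE R I. \<Prod>r\<in>R. f r (x r)) (\<Sum>x\<in>PiE R (F n). \<Prod>r\<in>R. f r (x r))"
      by (rule infsum_eq_upto[OF lf' fin _ outside]) (auto simp: F_def PiE_iff)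
    also have "(\<Sum>x\<in>PiE R (F n). \<Prod>r\<in>R. f r (x r)) = (\<Prod>r\<in>R. sum (f r) (F n r))"
      by (rule prod_sum_PiE[symmetric]) (use lf in \<open>auto simp: R F_def locally_finite_def\<close>)
    finally have 1: "eq_upto n (\<Sum>\<^sub>\<infinity>x\<in>PiE R I. \<Prod>r\<in>R. f r (x r)) (\<Prod>r\<in>R. sum (f r) (F n r))" .
    have 2: "eq_upto n (\<Prod>r\<in>R. infsum (f r) (I r)) (\<Prod>r\<in>R. sum (f r) (F n r))"
      by (intro eq_upto_prod infsum_eq_upto)
        (use lf in \<open>auto simp: F_def locally_finite_def\<close>)
    from 1 2 show "eq_upto n (\<Sum>\<^sub>\<infinity>x\<in>PiE R I. \<Prod>r\<in>R. f r (x r)) (\<Prod>r\<in>R. infsum (f r) (I r))"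
      by (rule eq_upto_join)
  qed
qed

text \<open>The box argument for two factors with different index types, as required for a charge
  (an integer) paired with a partition (a list).\<close>

lemma infsum_mult_Times:
  fixes f :: "'i \<Rightarrow> 'a::comm_ring_1 fps"
  assumes f: "locally_finite f I" and g: "locally_finite g J"
  shows "locally_finite (\<lambda>(i, j). f i * g j) (I \<times> J)"
    and "(\<Sum>\<^sub>\<infinity>(i, j)\<in>I \<times> J. f i * g j) = infsum f I * infsum g J"
proof -
  define F where "F n = {i \<in> I. \<not> eq_upto n (f i) 0}" for n
  define G where "G n = {j \<in> J. \<not> eq_upto n (g j) 0}" for n
  have fin: "finite (F n)" "finite (G n)" for n
    using f g by (auto simp: F_def G_def locally_finite_def)
  have outside: "eq_upto n (case p of (i, j) \<Rightarrow> f i * g j) 0" if "p \<in> I \<times> J - F n \<times> G n" for p n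
  proof -
    obtain i j where p: "p = (i, j)" by force
    with that consider "eq_upto n (f i) 0" | "eq_upto n (g j) 0"
      by (auto simp: F_def G_def)
    then show ?thesis
    proof cases
      case 1
      from eq_upto_mult[OF this eq_upto_refl, of "g j"] show ?thesis by (simp add: p)
    next
      case 2
      from eq_upto_mult[OF eq_upto_refl this, of "f i"] show ?thesis by (simp add: p)
    qed
  qed
  show lf': "locally_finite (\<lambda>(i, j). f i * g j) (I \<times> J)"
    unfolding locally_finite_def
  proof
    fix n
    show "finite {p \<in> I \<times> J. \<not> eq_upto n (case p of (i, j) \<Rightarrow> f i * g j) 0}"
      by (rule finite_subset[of _ "F n \<times> G n"]) (use outside fin in blast)+
  qed
  show "(\<Sum>\<^sub>\<infinity>(i, j)\<in>I \<times> J. f i * g j) = infsum f I * infsum g J"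
  proof (rule fps_eq_upto)
    fix n
    have "eq_upto n (\<Sum>\<^sub>\<infinity>(i, j)\<in>I \<times> J. f i * g j) (\<Sum>(i, j)\<in>F n \<times> G n. f i * g j)"
      by (rule infsum_eq_upto[OF lf' _ _ outside]) (use fin in \<open>auto simp: F_def G_def\<close>)
    also have "(\<Sum>(i, j)\<in>F n \<times> G n. f i * g j) = sum f (F n) * sum g (G n)"
      by (simp add: sum_product sum.cartesian_product)
    finally have 1: "eq_upto n (\<Sum>\<^sub>\<infinity>(i, j)\<in>I \<times> J. f i * g j) (sum f (F n) * sum g (G n))" .
    have 2: "eq_upto n (infsum f I * infsum g J) (sum f (F n) * sum g (G n))"
      by (intro eq_upto_mult infsum_eq_upto f g fin) (auto simp: F_def G_def)
    from 1 2 show "eq_upto n (\<Sum>\<^sub>\<infinity>(i, j)\<in>I \<times> J. f i * g j) (infsum f I * infsum g J)"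
      by (rule eq_upto_join)
  qed
qed

lemma infsum_sum_swap:
  fixes f :: "'r \<Rightarrow> 'i \<Rightarrow> 'a::ab_group_add fps"
  assumes R: "finite R" and lf: "\<And>r. r \<in> R \<Longrightarrow> locally_finite (f r) I"
  shows "(\<Sum>\<^sub>\<infinity>i\<in>I. \<Sum>r\<in>R. f r i) = (\<Sum>r\<in>R. infsum (f r) I)"
proof (rule fps_eq_upto)
  fix n
  \<comment> \<open>The union truncates all the sums at the same set, so that the finite sums can be
    swapped.\<close>
  define F where "F n = (\<Union>r\<in>R. {i \<in> I. \<not> eq_upto n (f r i) 0})" for n
  have fin: "finite (F n)" for n
    using lf R by (auto simp: F_def locally_finite_def)
  have outside: "eq_upto n (\<Sum>r\<in>R. f r i) 0" if "i \<in> I - F n" for i n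
    using that by (auto simp: F_def eq_upto_def fps_sum_nth intro!: sum.neutral)
  have lf': "locally_finite (\<lambda>i. \<Sum>r\<in>R. f r i) I"
    unfolding locally_finite_def using outside by (blast intro: finite_subset[OF _ fin])
  have "eq_upto n (\<Sum>\<^sub>\<infinity>i\<in>I. \<Sum>r\<in>R. f r i) (\<Sum>i\<in>F n. \<Sum>r\<in>R. f r i)"
    by (rule infsum_eq_upto[OF lf' fin _ outside]) (auto simp: F_def)
  also have "(\<Sum>i\<in>F n. \<Sum>r\<in>R. f r i) = (\<Sum>r\<in>R. sum (f r) (F n))"
    by (rule sum.swap)
  finally have 1: "eq_upto n (\<Sum>\<^sub>\<infinity>i\<in>I. \<Sum>r\<in>R. f r i) (\<Sum>r\<in>R. sum (f r) (F n))" .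
  have 2: "eq_upto n (\<Sum>r\<in>R. infsum (f r) I) (\<Sum>r\<in>R. sum (f r) (F n))"
  proof (rule eq_upto_sum)
    fix r assume "r \<in> R"
    then show "eq_upto n (infsum (f r) I) (sum (f r) (F n))"
      by (intro infsum_eq_upto lf fin) (use R in \<open>auto simp: F_def\<close>)
  qed
  from 1 2 show "eq_upto n (\<Sum>\<^sub>\<infinity>i\<in>I. \<Sum>r\<in>R. f r i) (\<Sum>r\<in>R. infsum (f r) I)"
    by (rule eq_upto_join)
qed

text \<open>Factor j is 1 modulo X^(j+1), so factors of index n or more leave the degrees up to n
  unchanged.\<close>

lemma prodinf_eq_upto:
  fixes u :: "nat \<Rightarrow> 'a::idom fps"
  assumes u: "\<And>j. eq_upto j (u j) 0" and N: "n \<le> N"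
  shows "eq_upto n (prodinf (\<lambda>j. 1 - u j)) (\<Prod>j<N. 1 - u j)"
proof -
  have step: "eq_upto n (\<Prod>j<N + d. 1 - u j) (\<Prod>j<N. 1 - u j)" if "n \<le> N" for n N d
  proof (induction d)
    case (Suc d)
    have "eq_upto n (u (N + d)) 0"
      by (rule eq_upto_mono[OF u]) (use that in simp)
    then have "eq_upto n (1 - u (N + d)) 1"
      by (simp add: eq_upto_def)
    from eq_upto_mult[OF Suc this] show ?case
      by simp
  qed simp
  \<comment> \<open>The limit is read off diagonally: coefficient n is already final after the first
    n factors.\<close>
  define P where "P = Abs_fps (\<lambda>n. fps_nth (\<Prod>j<n. 1 - u j) n)"
  have P: "eq_upto n P (\<Prod>j<N. 1 - u j)" if "n \<le> N" for n N
    unfolding eq_upto_def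
  proof (intro allI impI)
    fix k assume "k \<le> n"
    with that step[of k k "N - k"] show "fps_nth P k = fps_nth (\<Prod>j<N. 1 - u j) k"
      by (simp add: P_def eq_upto_def)
  qed
  have "(\<lambda>n. \<Prod>j\<le>n. 1 - u j) \<longlonglongrightarrow> P"
  proof (rule tendsto_fpsI)
    fix k
    show "\<forall>\<^sub>F n in sequentially. fps_nth (\<Prod>j\<le>n. 1 - u j) k = fps_nth P k"
      using eventually_ge_at_top[of k]
    proof eventually_elim
      case (elim n)
      then show ?case
        using P[of k "Suc n"] by (simp add: eq_upto_def lessThan_Suc_atMost)
    qed
  qed
  \<comment> \<open>\<open>has_prod\<close> demands a nonzero limit; the constant term is that of
    the empty product.\<close>
  moreover have "fps_nth P 0 = 1"
    by (simp add: P_def)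
  then have "P \<noteq> 0"
    by auto
  ultimately have "(\<lambda>j. 1 - u j) has_prod P"
    by (simp add: has_prod_def raw_has_prod_def)
  then have "prodinf (\<lambda>j. 1 - u j) = P"
    by (rule has_prod_unique[symmetric])
  then show ?thesis
    using P[OF N] by (simp only:)
qed

lemma locally_finite_subset:
  assumes "locally_finite f I" "J \<subseteq> I"
  shows "locally_finite f J"
proof -
  have "{i \<in> J. \<not> eq_upto n (f i) 0} \<subseteq> {i \<in> I. \<not> eq_upto n (f i) 0}" for n
    using assms(2) by blast
  then show ?thesis
    using assms(1) finite_subset unfolding locally_finite_def by blast
qed

lemma locally_finite_reindex:
  assumes "bij_betw g A B"
  shows "locally_finite (\<lambda>x. f (g x)) A \<longleftrightarrow> locally_finite f B"
proof -
  have "finite {x \<in> A. \<not> eq_upto n (f (g x)) 0} \<longleftrightarrow> finite {y \<in> B. \<not> eq_upto n (f y) 0}" for n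
  proof (rule bij_betw_finite)
    show "bij_betw g {x \<in> A. \<not> eq_upto n (f (g x)) 0} {y \<in> B. \<not> eq_upto n (f y) 0}"
      using assms by (auto simp: bij_betw_def inj_on_def)
  qed
  then show ?thesis
    by (simp add: locally_finite_def)
qed

lemma locally_finite_cong:
  assumes "\<And>x. x \<in> I \<Longrightarrow> f x = g x" "locally_finite f I"
  shows "locally_finite g I"
proof -
  have "{x \<in> I. \<not> eq_upto n (g x) 0} = {x \<in> I. \<not> eq_upto n (f x) 0}" for n
    using assms(1) by auto
  then show ?thesis
    using assms(2) by (simp add: locally_finite_def)
qed

lemma infsum_cmult_fps:
  fixes f :: "'i \<Rightarrow> 'a::comm_ring_1 fps"
  assumes "locally_finite f I"
  shows "locally_finite (\<lambda>i. c * f i) I" "(\<Sum>\<^sub>\<infinity>i\<in>I. c * f i) = c * infsum f I"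
proof -
  define F where "F n = {i \<in> I. \<not> eq_upto n (f i) 0}" for n
  have fin: "finite (F n)" for n
    using assms by (simp add: F_def locally_finite_def)
  have 0: "eq_upto n (c * f i) 0" if "i \<in> I - F n" for n i
    using that eq_upto_mult[of n c c "f i" 0] by (simp add: F_def)
  show lf: "locally_finite (\<lambda>i. c * f i) I"
    unfolding locally_finite_def using 0 by (blast intro: finite_subset[OF _ fin])
  show "(\<Sum>\<^sub>\<infinity>i\<in>I. c * f i) = c * infsum f I"
  proof (rule fps_eq_upto)
    fix n
    have "eq_upto n (\<Sum>\<^sub>\<infinity>i\<in>I. c * f i) (\<Sum>i\<in>F n. c * f i)"
      by (rule infsum_eq_upto[OF lf fin _ 0]) (auto simp: F_def)
    also have "(\<Sum>i\<in>F n. c * f i) = c * sum f (F n)"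
      by (simp add: sum_distrib_left)
    finally have 1: "eq_upto n (\<Sum>\<^sub>\<infinity>i\<in>I. c * f i) (c * sum f (F n))" .
    have 2: "eq_upto n (c * infsum f I) (c * sum f (F n))"
      by (intro eq_upto_mult infsum_eq_upto assms fin eq_upto_refl) (auto simp: F_def)
    from 1 2 show "eq_upto n (\<Sum>\<^sub>\<infinity>i\<in>I. c * f i) (c * infsum f I)"
      by (rule eq_upto_join)
  qed
qed

lemma infsum_Un_fps:
  fixes f :: "'i \<Rightarrow> 'a::ab_group_add fps"
  assumes lf: "locally_finite f (A \<union> B)" and disj: "A \<inter> B = {}"
  shows "infsum f (A \<union> B) = infsum f A + infsum f B"
proof (rule fps_eq_upto)
  fix n
  define F where "F I = {i \<in> I. \<not> eq_upto n (f i) 0}" for I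
  have lfs: "locally_finite f A" "locally_finite f B"
    using lf by (auto intro: locally_finite_subset)
  have approx: "eq_upto n (infsum f I) (sum f (F I))" if "locally_finite f I" for I
    using that by (intro infsum_eq_upto) (auto simp: F_def locally_finite_def)
  have "F (A \<union> B) = F A \<union> F B" "F A \<inter> F B = {}" "finite (F A)" "finite (F B)"
    using lfs disj by (auto simp: F_def locally_finite_def)
  then have "sum f (F (A \<union> B)) = sum f (F A) + sum f (F B)"
    by (simp add: sum.union_disjoint)
  then show "eq_upto n (infsum f (A \<union> B)) (infsum f A + infsum f B)"
    using approx[OF lf] approx[OF lfs(1)] approx[OF lfs(2)] by (simp add: eq_upto_def)
qed

lemma eq_upto_X_power: "n < k \<Longrightarrow> eq_upto n (fps_X ^ k :: 'a::comm_ring_1 fps) 0"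
  by (simp add: eq_upto_def fps_X_power_iff)

lemma eq_upto_X_power_mult: "n < k \<Longrightarrow> eq_upto n (fps_X ^ k * f) (0 :: 'a::comm_ring_1 fps)"
  using eq_upto_mult[OF eq_upto_X_power eq_upto_refl, of n k f] by simp

lemma qpochhammer_eq_upto:
  fixes a :: "'a::idom fps"
  assumes "fps_nth a 0 = 0" "0 < s" "n \<le> N"
  shows "eq_upto n (qpochhammer_inf a (fps_X ^ s)) (\<Prod>j<N. 1 - a * fps_X ^ (s * j))"
proof -
  have "eq_upto j (a * (fps_X ^ s) ^ j) 0" for j
  proof -
    have "fps_nth (a * fps_X ^ (s * j)) k = 0" if "k \<le> j" for k
    \<comment> \<open>A coefficient of index \<open>k \<le> j\<close> can survive only if
      \<open>s * j \<le> k\<close>, hence only at \<open>k = s * j\<close>, where it is the constant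
      term 0 of \<open>a\<close>.\<close>
    proof (cases "k < s * j")
      case False
      moreover have "j \<le> s * j"
        using assms(2) by (cases s) auto
      ultimately have "k = s * j"
        using that by linarith
      then show ?thesis
        using assms(1) by (simp add: fps_X_power_mult_right_nth)
    qed (simp add: fps_X_power_mult_right_nth)
    then show ?thesis
      by (simp add: eq_upto_def flip: power_mult)
  qed
  from prodinf_eq_upto[of "\<lambda>j. a * (fps_X ^ s) ^ j", OF this assms(3)] show ?thesis
    by (simp add: qpochhammer_inf_def power_mult)
qed

section \<open>Bead sets\<close>

text \<open>A new first row lowers the bead of every old row by one, which gives the recursion. The
  empty rows beyond the last part carry beads too, so the empty partition is the whole negative
  half-line.\<close>

primrec beads :: "nat list \<Rightarrow> int set" where
  "beads [] = {..<0}"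
| "beads (x # \<mu>) = insert (int x - 1) {y. y + 1 \<in> beads \<mu>}"

definition shift :: "int \<Rightarrow> int set \<Rightarrow> int set" where
  "shift c S = {y. y - c \<in> S}"

text \<open>The reflection y -> -1 - y swaps the half-lines \<open>{..<0}\<close> and
  \<open>{0..}\<close>, so the empty partition is self-dual.\<close>

definition dual :: "int set \<Rightarrow> int set" where
  "dual S = {y. - 1 - y \<notin> S}"

text \<open>Maya diagrams: sets that differ from the negative half-line in finitely many
  places.\<close>

definition maya :: "int set \<Rightarrow> bool" where
  "maya S \<longleftrightarrow> finite (S \<inter> {0..}) \<and> finite ({..<0} - S)"

text \<open>
  On the beads of a partition, weight \<open>1\<close> gives \<open>0\<close>, weight \<open>y\<close> gives the size, and the indicator of
  the even numbers gives the BG-rank.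
\<close>

definition wcharge :: "(int \<Rightarrow> int) \<Rightarrow> int set \<Rightarrow> int" where
  "wcharge w S = sum w (S \<inter> {0..}) - sum w ({..<0} - S)"

abbreviation charge :: "int set \<Rightarrow> int" where
  "charge \<equiv> wcharge (\<lambda>_. 1)"

abbreviation energy :: "int set \<Rightarrow> int" where
  "energy \<equiv> wcharge (\<lambda>y. y)"

lemma maya_bounds:
  assumes "maya S"
  obtains M N where "{..<M} \<subseteq> S" "S \<subseteq> {..<N}"
proof -
  obtain N where N: "\<And>y. y \<in> S \<inter> {0..} \<Longrightarrow> y \<le> N"
    using assms bdd_above_finite[of "S \<inter> {0..}"] by (auto simp: maya_def bdd_above_def)
  obtain M where M: "\<And>y. y \<in> {..<0} - S \<Longrightarrow> M \<le> y"
    using assms bdd_below_finite[of "{..<0} - S"] by (auto simp: maya_def bdd_below_def)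
  have "{..<min 0 M} \<subseteq> S"
    using M by force
  moreover have "S \<subseteq> {..<max 0 (N + 1)}"
    using N by force
  ultimately show ?thesis ..
qed

lemma maya_iff_bounds: "maya S \<longleftrightarrow> (\<exists>M N. {..<M} \<subseteq> S \<and> S \<subseteq> {..<N})"
proof
  assume "\<exists>M N. {..<M} \<subseteq> S \<and> S \<subseteq> {..<N}"
  then obtain M N where "{..<M} \<subseteq> S" "S \<subseteq> {..<N}"
    by blast
  then have "S \<inter> {0..} \<subseteq> {0..<N}" "{..<0} - S \<subseteq> {M..<0}"
    by (auto simp: subset_iff not_less[symmetric])
  then show "maya S"
    unfolding maya_def by (meson finite_atLeastLessThan_int finite_subset)
next
  assume "maya S"
  then show "\<exists>M N. {..<M} \<subseteq> S \<and> S \<subseteq> {..<N}"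
    by (rule maya_bounds) blast
qed

lemma shift_shift [simp]: "shift c (shift d S) = shift (c + d) S"
  by (simp add: shift_def diff_diff_eq)

lemma shift_0 [simp]: "shift 0 S = S"
  by (simp add: shift_def)

lemma shift_cancel: "shift c S = shift c T \<longleftrightarrow> S = T"
proof
  assume "shift c S = shift c T"
  then have "shift (- c) (shift c S) = shift (- c) (shift c T)"
    by simp
  then show "S = T"
    by simp
qed simp

lemma beads_Cons: "beads (x # \<mu>) = insert (int x - 1) (shift (- 1) (beads \<mu>))"
  by (simp add: shift_def)

lemma maya_shift:
  assumes "maya S"
  shows "maya (shift c S)"
proof -
  from assms obtain M N where MN: "{..<M} \<subseteq> S" "S \<subseteq> {..<N}"
    by (rule maya_bounds)
  have "{..<M + c} \<subseteq> shift c S" "shift c S \<subseteq> {..<N + c}"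
    using subsetD[OF MN(1)] subsetD[OF MN(2)] by (force simp: shift_def)+
  then show ?thesis
    unfolding maya_iff_bounds by blast
qed

lemma maya_insert:
  assumes "maya S"
  shows "maya (insert a S)"
proof -
  have "insert a S \<inter> {0..} \<subseteq> insert a (S \<inter> {0..})"
    by blast
  from finite_subset[OF this] show ?thesis
    using assms by (simp add: maya_def Diff_insert[of _ a S])
qed

lemma neg_Int_nonneg [simp]: "{..<0 :: int} \<inter> {0..} = {}"
  by auto

lemma maya_beads: "maya (beads \<mu>)"
proof (induction \<mu>)
  case Nil
  then show ?case
    by (simp add: maya_def)
qed (simp add: beads_Cons maya_insert maya_shift del: beads.simps)

lemma image_reflect_int: "(\<lambda>y. - 1 - y) ` A = {y. - 1 - y \<in> (A :: int set)}"
proof (intro set_eqI iffI)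
  fix y assume "y \<in> {y. - 1 - y \<in> A}"
  then have "- 1 - y \<in> A"
    by (simp only: mem_Collect_eq)
  then show "y \<in> (\<lambda>y. - 1 - y) ` A"
    by (rule rev_image_eqI) simp
next
  fix y assume "y \<in> (\<lambda>y. - 1 - y) ` A"
  then show "y \<in> {y. - 1 - y \<in> A}"
    by clarsimp
qed

lemma image_pred_int: "(\<lambda>y. y - 1) ` A = {y. y + 1 \<in> (A :: int set)}"
proof (intro set_eqI iffI)
  fix y assume "y \<in> {y. y + 1 \<in> A}"
  then have "y + 1 \<in> A"
    by (simp only: mem_Collect_eq)
  then show "y \<in> (\<lambda>y. y - 1) ` A"
    by (rule rev_image_eqI) simp
next
  fix y assume "y \<in> (\<lambda>y. y - 1) ` A"
  then show "y \<in> {y. y + 1 \<in> A}"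
    by clarsimp
qed

lemma dual_dual [simp]: "dual (dual S) = S"
  by (simp add: dual_def)

lemma dual_nonneg: "dual S \<inter> {0..} = (\<lambda>y. - 1 - y) ` ({..<0} - S)"
  by (auto simp: dual_def image_reflect_int)

lemma dual_neg: "{..<0} - dual S = (\<lambda>y. - 1 - y) ` (S \<inter> {0..})"
  by (auto simp: dual_def image_reflect_int)

lemma maya_dual: "maya S \<Longrightarrow> maya (dual S)"
  unfolding maya_def dual_nonneg dual_neg by simp

text \<open>Nonnegative beads and negative holes trade places under reflection, and they are counted
  with opposite signs.\<close>

lemma wcharge_dual: "wcharge w (dual S) = - wcharge (\<lambda>y. w (- 1 - y)) S"
  unfolding wcharge_def dual_nonneg dual_neg
  by (simp add: sum.reindex inj_on_def o_def)

lemma wcharge_cmult: "wcharge (\<lambda>y. c * w y) S = c * wcharge w S"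
  by (simp add: wcharge_def sum_distrib_left right_diff_distrib)

lemma wcharge_add: "wcharge (\<lambda>y. v y + w y) S = wcharge v S + wcharge w S"
  by (simp add: wcharge_def sum.distrib)

lemma wcharge_diff: "wcharge (\<lambda>y. v y - w y) S = wcharge v S - wcharge w S"
  by (simp add: wcharge_def sum_subtractf)

lemma wcharge_const: "wcharge (\<lambda>_. c) S = c * charge S"
  using wcharge_cmult[of c "\<lambda>_. 1"] by simp

lemma wcharge_affine: "wcharge (\<lambda>y. c * y + d) S = c * energy S + d * charge S"
  by (simp only: wcharge_add wcharge_cmult wcharge_const[of d])

text \<open>A new bead at a negative \<open>a\<close> fills a hole that was counted with a minus
  sign, so the change is the same on both sides of the cutoff.\<close>

lemma wcharge_insert:
  assumes "maya S" "a \<notin> S"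
  shows "wcharge w (insert a S) = wcharge w S + w a"
proof (cases "a \<ge> 0")
  case True
  then have "insert a S \<inter> {0..} = insert a (S \<inter> {0..})" "{..<0} - insert a S = {..<0} - S"
    by auto
  then show ?thesis
    using assms by (simp add: wcharge_def maya_def)
next
  case False
  then have "insert a S \<inter> {0..} = S \<inter> {0..}" "{..<0} - S = insert a ({..<0} - insert a S)"
    using assms by auto
  moreover have "finite ({..<0} - insert a S)"
    using maya_insert[OF assms(1)] by (simp add: maya_def)
  ultimately have "sum w (insert a S \<inter> {0..}) = sum w (S \<inter> {0..})"
      "sum w ({..<0} - S) = w a + sum w ({..<0} - insert a S)"
    by (metis, metis DiffD2 insertI1 sum.insert)
  then show ?thesis
    by (simp add: wcharge_def)
qed

text \<open>Only position 0 crosses the cutoff. A bead there leaves the nonnegative part, a hole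
  there joins the negative holes; either way \<open>w (- 1)\<close> is subtracted.\<close>

lemma wcharge_shift_down:
  assumes "maya S"
  shows "wcharge w (shift (- 1) S) = wcharge (\<lambda>y. w (y - 1)) S - w (- 1)"
proof -
  have pos: "shift (- 1) S \<inter> {0..} = (\<lambda>y. y - 1) ` (S \<inter> {0..} - {0})"
    unfolding image_pred_int by (auto simp: shift_def)
  have neg: "{..<0} - shift (- 1) S = (\<lambda>y. y - 1) ` (({..<0} - S) \<union> ({0} - S))"
    unfolding image_pred_int by (auto simp: shift_def)
  have fin: "finite (S \<inter> {0..})" "finite ({..<0} - S)"
    using assms by (auto simp: maya_def)
  have "sum w (shift (- 1) S \<inter> {0..}) = (\<Sum>y\<in>S \<inter> {0..} - {0}. w (y - 1))"
    unfolding pos by (simp add: sum.reindex inj_on_def)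
  also have "\<dots> = (\<Sum>y\<in>S \<inter> {0..}. w (y - 1)) - (if 0 \<in> S then w (- 1) else 0)"
    using fin by (simp add: sum_diff1)
  finally have 1: "sum w (shift (- 1) S \<inter> {0..}) = \<dots>" .
  have "sum w ({..<0} - shift (- 1) S) = (\<Sum>y\<in>({..<0} - S) \<union> ({0} - S). w (y - 1))"
    unfolding neg by (simp add: sum.reindex inj_on_def)
  also have "\<dots> = (\<Sum>y\<in>{..<0} - S. w (y - 1)) + (\<Sum>y\<in>{0} - S. w (y - 1))"
    using fin by (intro sum.union_disjoint) auto
  also have "(\<Sum>y\<in>{0} - S. w (y - 1)) = (if 0 \<in> S then 0 else w (- 1))"
    by (cases "0 \<in> S") (simp_all add: insert_Diff_if)
  finally show ?thesis
    using 1 by (simp add: wcharge_def)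
qed

text \<open>Unit shifts, iterated in both directions, add consecutive charges to the energy, whence
  c(c - 1)/2; everything is doubled to stay within the integers.\<close>

lemma charge_energy_shift:
  assumes "maya S"
  shows "charge (shift c S) = charge S + c \<and>
    2 * energy (shift c S) = 2 * energy S + 2 * c * charge S + c * (c - 1)"
proof -
  have down: "charge (shift (c - 1) S) = charge (shift c S) - 1"
    "energy (shift (c - 1) S) = energy (shift c S) - charge (shift c S) + 1" for c
    using wcharge_shift_down[OF maya_shift[OF assms, of c], of "\<lambda>_. 1"]
      wcharge_shift_down[OF maya_shift[OF assms, of c], of "\<lambda>y. y"]
    by (simp_all add: wcharge_diff)
  show ?thesis
  proof (induction c rule: int_induct[of _ 0])
    case (step1 i)
    with down[of "i + 1"] show ?case
      by (simp add: algebra_simps)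
  next
    case (step2 i)
    with down[of i] show ?case
      by (simp add: algebra_simps)
  qed simp
qed

lemmas charge_shift = charge_energy_shift[THEN conjunct1]
  and energy_shift = charge_energy_shift[THEN conjunct2]

section \<open>Partitions as bead sets of charge zero\<close>

lemma partitions_Cons:
  "x # \<mu> \<in> partitions \<longleftrightarrow> 0 < x \<and> (\<forall>y\<in>set \<mu>. y \<le> x) \<and> \<mu> \<in> partitions"
  by (auto simp: partitions_def)

lemma Nil_partitions [simp]: "[] \<in> partitions"
  by (simp add: partitions_def)

lemma beads_bound:
  assumes "\<mu> \<in> partitions" "\<forall>y\<in>set \<mu>. y \<le> x"
  shows "beads \<mu> \<subseteq> {..<int x}"
  using assms
proof (induction \<mu> arbitrary: x)
  case (Cons y \<mu>)
  have "beads \<mu> \<subseteq> {..<int y}"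
    using Cons by (auto simp: partitions_Cons)
  then show ?case
    using Cons.prems by (fastforce simp: subset_iff)
qed auto

text \<open>The beads of \<open>\<mu>\<close> lie below \<open>x\<close>, so the lowered ones lie
  below \<open>x - 1\<close>. This makes \<open>wcharge_insert\<close> applicable to the first
  row.\<close>

lemma beads_Cons_disjoint:
  assumes "x # \<mu> \<in> partitions"
  shows "int x - 1 \<notin> shift (- 1) (beads \<mu>)"
  using beads_bound[of \<mu> x] assms by (auto simp: partitions_Cons shift_def)

lemma wcharge_beads_Cons:
  assumes "x # \<mu> \<in> partitions"
  shows "wcharge w (beads (x # \<mu>)) = wcharge (\<lambda>y. w (y - 1)) (beads \<mu>) + w (int x - 1) - w (- 1)"
  unfolding beads_Cons
  by (subst wcharge_insert)
    (use beads_Cons_disjoint[OF assms] in \<open>auto simp: maya_shift maya_beads wcharge_shift_down\<close>)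

lemma charge_beads: "\<mu> \<in> partitions \<Longrightarrow> charge (beads \<mu>) = 0"
proof (induction \<mu>)
  case (Cons x \<mu>)
  then show ?case
    using wcharge_beads_Cons[of x \<mu> "\<lambda>_. 1"] by (simp add: partitions_Cons)
qed (simp add: wcharge_def)

lemma energy_beads: "\<mu> \<in> partitions \<Longrightarrow> energy (beads \<mu>) = int (sum_list \<mu>)"
proof (induction \<mu>)
  case (Cons x \<mu>)
  then show ?case
    using wcharge_beads_Cons[of x \<mu> "\<lambda>y. y"]
    by (simp add: partitions_Cons wcharge_diff charge_beads)
qed (simp add: wcharge_def)

text \<open>The largest bead is the first part minus one; removing it and undoing the shift leaves
  the beads of the remaining parts.\<close>

lemma beads_inject:
  assumes "\<mu> \<in> partitions" "\<nu> \<in> partitions" "beads \<mu> = beads \<nu>"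
  shows "\<mu> = \<nu>"
proof -
  have Nil: "beads (y # \<nu>) \<noteq> {..<0}" if "y # \<nu> \<in> partitions" for y \<nu>
  proof -
    have "int y - 1 \<in> beads (y # \<nu>)" "0 < y"
      using that by (simp_all add: partitions_Cons)
    then have "int y - 1 \<in> beads (y # \<nu>) - {..<0}"
      by (simp only: Diff_iff lessThan_iff) simp
    then show ?thesis
      by blast
  qed
  show ?thesis
    using assms
  proof (induction \<mu> \<nu> rule: list_induct2')
    case (2 x \<mu>)
    then show ?case
      using Nil[of x \<mu>] by (simp only: beads.simps(1))
  next
    case (3 y \<nu>)
    then show ?case
      using Nil[of y \<nu>] by (metis beads.simps(1))
  next
    case (4 x \<mu> y \<nu>)
    have disj: "int x - 1 \<notin> shift (- 1) (beads \<mu>)" "int y - 1 \<notin> shift (- 1) (beads \<nu>)"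
      using "4.prems" by (auto intro!: beads_Cons_disjoint simp del: beads.simps)
    have le: "beads (x # \<mu>) \<subseteq> {..<int x}" "beads (y # \<nu>) \<subseteq> {..<int y}"
      using "4.prems" by (intro beads_bound; simp add: partitions_Cons)+
    have "int x - 1 \<in> beads (x # \<mu>)" "int y - 1 \<in> beads (y # \<nu>)"
      by simp_all
    then have "int x - 1 \<in> {..<int y}" "int y - 1 \<in> {..<int x}"
      using le "4.prems"(3) by (blast, blast)
    then have "x = y"
      by simp
    have "shift (- 1) (beads \<mu>) = shift (- 1) (beads \<nu>)"
      using disj "4.prems"(3) unfolding beads_Cons \<open>x = y\<close> by (rule insert_ident[THEN iffD1])
    then have "beads \<mu> = beads \<nu>"
      by (simp only: shift_cancel)
    then show ?case
      using "4.IH" "4.prems"(1,2) \<open>x = y\<close> by (simp only: partitions_Cons)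
  qed simp
qed

text \<open>Induction on the number \<open>n\<close> of beads at or above a level \<open>M\<close>
  below which everything is filled. The largest bead becomes the first row. Each bead at or above
  the level raises the charge by one, hence the shift \<open>M + int n\<close>.\<close>

lemma maya_eq_shift_beads:
  assumes "maya S"
  obtains c \<mu> where "\<mu> \<in> partitions" "S = shift c (beads \<mu>)"
proof -
  have "\<exists>\<mu>\<in>partitions. S = shift (M + int n) (beads \<mu>)"
    if "{..<M} \<subseteq> S" "finite (S \<inter> {M..})" "card (S \<inter> {M..}) = n" for S M n
    using that
  proof (induction n arbitrary: S)
    case 0
    then have "S = {..<M}"
      by (auto simp: not_less[symmetric])
    then show ?case
      by (intro bexI[of _ "[]"]) (auto simp: shift_def)
  next
    case (Suc n)
    define a where "a = Max (S \<inter> {M..})"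
    have ne: "S \<inter> {M..} \<noteq> {}"
      using Suc.prems by auto
    have a: "a \<in> S" "M \<le> a"
      using Max_in[OF Suc.prems(2) ne] by (auto simp: a_def)
    have a_max: "y \<le> a" if "y \<in> S" for y
    proof (cases "y < M")
      case False
      then show ?thesis
        using that Suc.prems unfolding a_def by (intro Max_ge) auto
    qed (use a in simp)
    have "(S - {a}) \<inter> {M..} = S \<inter> {M..} - {a}"
      by auto
    then have "\<exists>\<mu>\<in>partitions. S - {a} = shift (M + int n) (beads \<mu>)"
      using Suc.prems a by (intro Suc.IH) auto
    then obtain \<mu> where \<mu>: "\<mu> \<in> partitions" "S - {a} = shift (M + int n) (beads \<mu>)"
      by blast
    have below: "y < a - (M + int n)" if "y \<in> beads \<mu>" for y
    proof -
      have "y + (M + int n) \<in> S - {a}"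
        unfolding \<mu>(2) using that by (simp add: shift_def)
      then show ?thesis
        using a_max[of "y + (M + int n)"] by auto
    qed
    have S: "S = insert a (shift (M + int n) (beads \<mu>))"
      using a \<mu>(2) by blast
    show ?case
    proof (cases \<mu>)
      case Nil
      have "0 \<le> a - (M + int n)"
        using below[of "-1"] Nil by simp
      then obtain x where x: "a = M + int n + int x"
        using that[of "nat (a - (M + int n))"] by simp
      show ?thesis
      \<comment> \<open>Zero is not a part: a bead sitting directly on top of a filled half-line
        only raises the charge.\<close>
      proof (cases "x = 0")
        case True
        then show ?thesis
          using S x Nil by (intro bexI[of _ "[]"]) (auto simp: shift_def)
      next
        case False
        then show ?thesis
          using S x Nil by (intro bexI[of _ "[x]"]) (auto simp: shift_def partitions_def)
      qed
    next
      case (Cons y \<mu>')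
      have "int y \<le> a - (M + int n)"
        using below[of "int y - 1"] Cons by simp
      then obtain x where x: "a = M + int n + int x" "y \<le> x"
        using that[of "nat (a - (M + int n))"] by simp
      have "x # \<mu> \<in> partitions"
        using \<mu>(1) x(2) Cons by (auto simp: partitions_Cons)
      then show ?thesis
        using S x(1) by (intro bexI[of _ "x # \<mu>"]) (auto simp: shift_def algebra_simps)
    qed
  qed
  note * = this
  from assms obtain M N where MN: "{..<M} \<subseteq> S" "S \<subseteq> {..<N}"
    by (rule maya_bounds)
  then have "S \<inter> {M..} \<subseteq> {M..<N}"
    by auto
  then have "finite (S \<inter> {M..})"
    by (rule finite_subset) simp
  from *[OF MN(1) this refl] show ?thesis
    using that by blast
qed

text \<open>Beads of partitions have charge 0, so the charge recovers \<open>c\<close>, and the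
  shift can then be undone.\<close>

lemma bij_betw_shift_beads:
  "bij_betw (\<lambda>(c, \<mu>). shift c (beads \<mu>)) (UNIV \<times> partitions) (Collect maya)"
proof (rule bij_betwI')
  fix p q :: "int \<times> nat list"
  assume pq: "p \<in> UNIV \<times> partitions" "q \<in> UNIV \<times> partitions"
  obtain c \<mu> d \<nu> where [simp]: "p = (c, \<mu>)" "q = (d, \<nu>)"
    by force
  have "c = d" if "shift c (beads \<mu>) = shift d (beads \<nu>)"
    using charge_shift[OF maya_beads, of c \<mu>] charge_shift[OF maya_beads, of d \<nu>] pq that
    by (simp add: charge_beads)
  then show "(case p of (c, \<mu>) \<Rightarrow> shift c (beads \<mu>)) = (case q of (c, \<mu>) \<Rightarrow> shift c (beads \<mu>))
      \<longleftrightarrow> p = q"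
    using beads_inject pq by (auto simp: shift_cancel)
next
  fix S assume "S \<in> Collect maya"
  then obtain c \<mu> where "\<mu> \<in> partitions" "S = shift c (beads \<mu>)"
    using maya_eq_shift_beads by blast
  then show "\<exists>p\<in>UNIV \<times> partitions. S = (case p of (c, \<mu>) \<Rightarrow> shift c (beads \<mu>))"
    by (intro bexI[of _ "(c, \<mu>)"]) auto
qed (auto intro: maya_shift maya_beads)

section \<open>Rows, columns and the boundary of the diagram\<close>

lemma part_Nil [simp]: "part [] i = 0"
  by (simp add: part_def)

lemma part_Cons_Suc: "part (x # \<mu>) (Suc i) = (if i = 0 then x else part \<mu> i)"
  by (cases i) (auto simp: part_def)

lemma beads_eq_parts: "y \<in> beads \<mu> \<longleftrightarrow> (\<exists>i\<ge>1. y = int (part \<mu> i) - int i)"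
proof (induction \<mu> arbitrary: y)
  case Nil
  have "\<exists>i\<ge>1. y = - int i" if "y < 0"
    using that by (intro exI[of _ "nat (- y)"]) auto
  then show ?case
    by auto
next
  case (Cons x \<mu>)
  have "y \<in> beads (x # \<mu>) \<longleftrightarrow> y = int x - 1 \<or> (\<exists>i\<ge>1. y + 1 = int (part \<mu> i) - int i)"
    using Cons.IH[of "y + 1"] by simp
  also have "\<dots> \<longleftrightarrow> (\<exists>i. y = int (part (x # \<mu>) (Suc i)) - int (Suc i))"
  proof
    assume "y = int x - 1 \<or> (\<exists>i\<ge>1. y + 1 = int (part \<mu> i) - int i)"
    then show "\<exists>i. y = int (part (x # \<mu>) (Suc i)) - int (Suc i)"
    proof
      assume "y = int x - 1"
      then show ?thesis
        by (intro exI[of _ 0]) (simp add: part_Cons_Suc)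
    next
      assume "\<exists>i\<ge>1. y + 1 = int (part \<mu> i) - int i"
      then obtain i where "i \<ge> 1" "y + 1 = int (part \<mu> i) - int i"
        by blast
      then show ?thesis
        by (intro exI[of _ i]) (simp add: part_Cons_Suc)
    qed
  next
    assume "\<exists>i. y = int (part (x # \<mu>) (Suc i)) - int (Suc i)"
    then obtain i where i: "y = int (part (x # \<mu>) (Suc i)) - int (Suc i)"
      by blast
    show "y = int x - 1 \<or> (\<exists>i\<ge>1. y + 1 = int (part \<mu> i) - int i)"
    proof (cases "i = 0")
      case True
      then show ?thesis
        using i by (simp add: part_Cons_Suc)
    next
      case False
      then have "i \<ge> 1 \<and> y + 1 = int (part \<mu> i) - int i"
        using i by (simp add: part_Cons_Suc)
      then show ?thesis
        by blast
    qed
  qed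
  also have "\<dots> \<longleftrightarrow> (\<exists>i\<ge>1. y = int (part (x # \<mu>) i) - int i)"
    by (metis One_nat_def Suc_le_D Suc_le_mono le0)
  finally show ?case .
qed

lemma part_antimono:
  assumes "\<mu> \<in> partitions" "1 \<le> i" "i \<le> i'"
  shows "part \<mu> i' \<le> part \<mu> i"
proof (cases "i = i' \<or> i' > length \<mu>")
  case False
  then have "i - 1 < i' - 1" "i' - 1 < length \<mu>"
    using assms by auto
  then have "\<mu> ! (i' - 1) \<le> \<mu> ! (i - 1)"
    using assms(1) sorted_wrt_nth_less[of "(\<ge>)" \<mu> "i - 1" "i' - 1"] by (simp add: partitions_def)
  then show ?thesis
    using False assms by (simp add: part_def)
qed (auto simp: part_def)

lemma length_conjugate [simp]: "length (conjugate \<mu>) = part \<mu> 1"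
  by (simp add: conjugate_def del: upt_Suc)

lemma nth_conjugate:
  "j < part \<mu> 1 \<Longrightarrow>
    conjugate \<mu> ! j = card {i. 1 \<le> i \<and> i \<le> length \<mu> \<and> Suc j \<le> part \<mu> i}"
  by (simp add: conjugate_def del: upt_Suc)

lemma part_conjugate:
  assumes "\<mu> \<in> partitions" "1 \<le> j"
  shows "part (conjugate \<mu>) j = card {i. 1 \<le> i \<and> i \<le> length \<mu> \<and> j \<le> part \<mu> i}"
proof (cases "j \<le> part \<mu> 1")
  case True
  then show ?thesis
    using assms nth_conjugate[of "j - 1" \<mu>] by (simp add: part_def[of "conjugate \<mu>"])
next
  case False
  then have "{i. 1 \<le> i \<and> i \<le> length \<mu> \<and> j \<le> part \<mu> i} = {}"
    using part_antimono[OF assms(1) le_refl] by fastforce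
  moreover have "part (conjugate \<mu>) j = 0"
    using False by (simp add: part_def[of "conjugate \<mu>"])
  ultimately show ?thesis
    by (simp only: card.empty)
qed

text \<open>The parts decrease, so the rows of length at least \<open>j\<close> form an initial
  segment \<open>A\<close>. Its size is the height of column \<open>j\<close>, so \<open>i\<close>
  is at most this height exactly when row \<open>i\<close> is in \<open>A\<close>.\<close>

lemma le_part_conjugate:
  assumes "\<mu> \<in> partitions" "1 \<le> i" "1 \<le> j"
  shows "i \<le> part (conjugate \<mu>) j \<longleftrightarrow> j \<le> part \<mu> i"
proof -
  define A where "A = {i. 1 \<le> i \<and> i \<le> length \<mu> \<and> j \<le> part \<mu> i}"
  have A: "i \<in> A \<longleftrightarrow> 1 \<le> i \<and> j \<le> part \<mu> i" for i
    using assms(3) by (auto simp: A_def part_def split: if_splits)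
  have fin: "finite A"
    by (rule finite_subset[of _ "{..length \<mu>}"]) (auto simp: A_def)
  show ?thesis
  proof
    assume "j \<le> part \<mu> i"
    then have "{1..i} \<subseteq> A"
      using part_antimono[OF assms(1)] by (force simp: A)
    then show "i \<le> part (conjugate \<mu>) j"
      using card_mono[OF fin, of "{1..i}"] part_conjugate[OF assms(1,3)] by (simp add: A_def)
  next
    assume i: "i \<le> part (conjugate \<mu>) j"
    show "j \<le> part \<mu> i"
    proof (rule ccontr)
      assume "\<not> j \<le> part \<mu> i"
      then have "A \<subseteq> {1..<i}"
        using part_antimono[OF assms(1,2)] by (fastforce simp: A not_le[symmetric])
      then have "card A \<le> i - 1"
        using card_mono[of "{1..<i}" A] by simp
      then show False
        using i assms(2) part_conjugate[OF assms(1,3)] by (simp add: A_def)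
    qed
  qed
qed

lemma conjugate_partitions:
  assumes "\<mu> \<in> partitions"
  shows "conjugate \<mu> \<in> partitions"
proof -
  have "sorted_wrt (\<ge>) (conjugate \<mu>)"
    unfolding sorted_wrt_iff_nth_less
  proof (intro allI impI)
    fix i j assume ij: "i < j" "j < length (conjugate \<mu>)"
    have "part (conjugate \<mu>) (Suc j) \<le> part (conjugate \<mu>) (Suc i)"
      unfolding part_conjugate[OF assms] using ij
      by (subst (1 2) part_conjugate[OF assms]; force intro: card_mono)
    then show "conjugate \<mu> ! i \<ge> conjugate \<mu> ! j"
      using ij by (simp add: part_def)
  qed
  moreover have "0 < p" if "p \<in> set (conjugate \<mu>)" for p
  proof -
    from that obtain j where j: "j < length (conjugate \<mu>)" "p = conjugate \<mu> ! j"
      by (metis in_set_conv_nth)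
    then have "1 \<le> part (conjugate \<mu>) (Suc j)"
      by (subst le_part_conjugate[OF assms]) auto
    then show ?thesis
      using j by (simp add: part_def)
  qed
  ultimately show ?thesis
    by (simp add: partitions_def)
qed

text \<open>Beads and holes are the vertical and horizontal steps of the boundary path; each column
  owns one hole. If the bead of row i were the hole of column j, row length plus column height would
  be i + j - 1, but by \<open>le_part_conjugate\<close> this sum is at least i + j or at most i + j
  - 2.\<close>

lemma not_beads_eq_parts:
  assumes "\<mu> \<in> partitions"
  shows "y \<notin> beads \<mu> \<longleftrightarrow> (\<exists>j\<ge>1. y = int j - 1 - int (part (conjugate \<mu>) j))"
proof
  assume "\<exists>j\<ge>1. y = int j - 1 - int (part (conjugate \<mu>) j)"
  then obtain j where j: "1 \<le> j" "y = int j - 1 - int (part (conjugate \<mu>) j)"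
    by blast
  show "y \<notin> beads \<mu>"
  proof
    assume "y \<in> beads \<mu>"
    then obtain i where i: "1 \<le> i" "y = int (part \<mu> i) - int i"
      by (auto simp: beads_eq_parts)
    then show False
      using le_part_conjugate[OF assms i(1) j(1)] j(2) by linarith
  qed
next
  assume y: "y \<notin> beads \<mu>"
  define P where "P k \<longleftrightarrow> 1 \<le> k \<and> int (part \<mu> k) - int k \<le> y" for k
  \<comment> \<open>The first row whose bead is at most \<open>y\<close>. As \<open>y\<close> is no
    bead, column \<open>y + k\<close> meets row \<open>k - 1\<close> but not row \<open>k\<close>,
    so its height is \<open>k - 1\<close>.\<close>
  define k where "k = (LEAST k. P k)"
  \<comment> \<open>Beyond the last part the bead of row k is -k, which is at most \<open>y\<close>
    once k is at least -y.\<close>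
  have "P (max (Suc (length \<mu>)) (nat (- y)))"
    by (auto simp: P_def part_def)
  then have "P k"
    unfolding k_def by (rule LeastI)
  moreover have "y \<noteq> int (part \<mu> k) - int k"
    using y \<open>P k\<close> by (auto simp: beads_eq_parts P_def)
  ultimately have k: "1 \<le> k" "int (part \<mu> k) - int k < y"
    by (auto simp: P_def)
  define j where "j = nat (y + int k)"
  have j: "1 \<le> j" "int j = y + int k" "\<not> j \<le> part \<mu> k"
    using k by (auto simp: j_def)
  have "\<not> k \<le> part (conjugate \<mu>) j"
    using le_part_conjugate[OF assms k(1) j(1)] j(3) by simp
  moreover have "k - 1 \<le> part (conjugate \<mu>) j"
  proof (cases "k = 1")
    case False
    then have "1 \<le> k - 1" "\<not> P (k - 1)"
      using k(1) not_less_Least[of "k - 1" P] by (auto simp: k_def)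
    then have "j \<le> part \<mu> (k - 1)"
      using k(1) j(2) by (auto simp: P_def)
    then show ?thesis
      using le_part_conjugate[OF assms \<open>1 \<le> k - 1\<close> j(1)] by simp
  qed simp
  ultimately have "y = int j - 1 - int (part (conjugate \<mu>) j)"
    using j(2) k(1) by simp
  then show "\<exists>j\<ge>1. y = int j - 1 - int (part (conjugate \<mu>) j)"
    using j(1) by blast
qed

text \<open>The hole of column j is the reflection of the bead of the j-th part of the
  conjugate.\<close>

lemma beads_conjugate:
  assumes "\<mu> \<in> partitions"
  shows "beads (conjugate \<mu>) = dual (beads \<mu>)"
proof -
  have "- 1 - y = int j - 1 - p \<longleftrightarrow> y = p - int j" for y j p
    by auto
  then show ?thesis
    by (auto simp: dual_def beads_eq_parts[of _ "conjugate \<mu>"] not_beads_eq_parts[OF assms])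
qed

lemma self_conjugate_iff:
  "\<mu> \<in> self_conjugate_partitions \<longleftrightarrow> \<mu> \<in> partitions \<and> dual (beads \<mu>) = beads \<mu>"
  unfolding self_conjugate_partitions_def mem_Collect_eq
  by (metis beads_inject conjugate_partitions beads_conjugate)

section \<open>Size and BG-rank of the diagram\<close>

lemma diagram_eq_Sigma: "diagram \<mu> = (SIGMA i:{1..length \<mu>}. {1..part \<mu> i})"
  by (auto simp: diagram_def)

lemma finite_diagram [simp]: "finite (diagram \<mu>)"
  by (simp add: diagram_eq_Sigma)

lemma sum_diagram: "(\<Sum>(i, j)\<in>diagram \<mu>. f i j) = (\<Sum>i<length \<mu>. \<Sum>j=1..\<mu> ! i. f (Suc i) j)"
proof -
  have "(\<Sum>(i, j)\<in>diagram \<mu>. f i j) = (\<Sum>i=1..length \<mu>. \<Sum>j=1..part \<mu> i. f i j)"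
    unfolding diagram_eq_Sigma by (rule sum.Sigma[symmetric]) auto
  also have "\<dots> = (\<Sum>i<length \<mu>. \<Sum>j=1..part \<mu> (Suc i). f (Suc i) j)"
    using sum.atLeast_Suc_atMost_Suc_shift[of _ 0 "length \<mu>"]
    by (metis (no_types, lifting) One_nat_def atLeast0LessThan atLeastLessThanSuc_atLeastAtMost
        sum.cong sum.shift_bounds_Suc_ivl)
  also have "\<dots> = (\<Sum>i<length \<mu>. \<Sum>j=1..\<mu> ! i. f (Suc i) j)"
    by (rule sum.cong) (auto simp: part_def)
  finally show ?thesis .
qed

lemma card_diagram: "card (diagram \<mu>) = sum_list \<mu>"
  using sum_diagram[of "\<lambda>_ _. 1 :: nat" \<mu>]
  by (simp add: sum_list_sum_nth atLeast0LessThan split_def)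

lemma size_hooks: "size (hooks \<mu>) = sum_list \<mu>"
  by (simp add: hooks_def card_diagram)

lemma sum_alternating: "(\<Sum>j=Suc 0..x. (- 1 :: int) ^ j) = (if even x then 0 else - 1)"
  by (induction x) auto

lemma BG_rank_Nil: "BG_rank [] = 0"
  by (simp add: BG_rank_def diagram_eq_Sigma)

text \<open>Deleting the first row moves all other boxes up by one and flips their signs; the signs
  of the first row start with +1 and cancel in pairs.\<close>

lemma BG_rank_Cons: "BG_rank (x # \<mu>) = (if even x then 0 else 1) - BG_rank \<mu>"
proof -
  have "BG_rank \<mu> = (\<Sum>i<length \<mu>. \<Sum>j=1..\<mu> ! i. (- 1) ^ (Suc i + j))" for \<mu>
    unfolding BG_rank_def by (rule sum_diagram)
  then have BG: "BG_rank \<mu> = (\<Sum>i<length \<mu>. (- 1) ^ Suc i * (\<Sum>j=1..\<mu> ! i. (- 1) ^ j))" for \<mu>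
    by (simp only: power_add sum_distrib_left)
  show ?thesis
    unfolding BG[of "x # \<mu>"] BG[of \<mu>] length_Cons sum.lessThan_Suc_shift
    by (simp add: sum_alternating sum_negf)
qed

text \<open>Lowering the beads by one turns the parity indicator into one minus itself. The charge
  is 0, so the constant drops out and the recursion is that of \<open>BG_rank_Cons\<close>.\<close>

lemma BG_rank_eq_wcharge:
  "\<mu> \<in> partitions \<Longrightarrow> BG_rank \<mu> = wcharge (\<lambda>y. if even y then 1 else 0) (beads \<mu>)"
proof (induction \<mu>)
  case Nil
  then show ?case
    by (simp add: BG_rank_Nil wcharge_def)
next
  case (Cons x \<mu>)
  have even_diff_one: "even (y - 1) \<longleftrightarrow> odd y" for y :: int
    by presburger
  have "(\<lambda>y :: int. if even (y - 1) then 1 else 0 :: int) = (\<lambda>y. 1 - (if even y then 1 else 0))"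
    by (simp add: even_diff_one fun_eq_iff)
  then show ?case
    using Cons wcharge_beads_Cons[of x \<mu> "\<lambda>y. if even y then 1 else 0"]
    by (simp add: partitions_Cons BG_rank_Cons wcharge_diff charge_beads del: beads.simps)
qed

section \<open>Hooks as inversions\<close>

definition inversions :: "int set \<Rightarrow> (int \<times> int) set" where
  "inversions S = {(a, b). a \<in> S \<and> b \<notin> S \<and> b < a}"

text \<open>Written as a sum of singletons so that the reindexing rules of \<open>sum\<close> apply
  to multisets.\<close>

definition maya_hooks :: "int set \<Rightarrow> nat multiset" where
  "maya_hooks S = (\<Sum>(a, b)\<in>inversions S. {#nat (a - b)#})"

lemma image_mset_mset_set: "finite A \<Longrightarrow> image_mset f (mset_set A) = (\<Sum>x\<in>A. {#f x#})"
  by (induction A rule: finite_induct) auto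

lemma finite_inversions:
  assumes "maya S"
  shows "finite (inversions S)"
proof -
  from assms obtain M N where MN: "{..<M} \<subseteq> S" "S \<subseteq> {..<N}"
    by (rule maya_bounds)
  have "inversions S \<subseteq> {M..<N} \<times> {M..<N}"
  proof
    fix p assume p: "p \<in> inversions S"
    obtain a b where ab: "p = (a, b)"
      by force
    with p have "a \<in> S" "b \<notin> S" "b < a"
      by (auto simp: inversions_def)
    then have "a < N" "M \<le> b"
      using MN by (blast, meson lessThan_iff not_le subsetD)
    with \<open>b < a\<close> show "p \<in> {M..<N} \<times> {M..<N}"
      by (simp add: ab)
  qed
  then show ?thesis
    by (rule finite_subset) simp
qed

lemma maya_hooks_shift: "maya_hooks (shift c S) = maya_hooks S"
  unfolding maya_hooks_def
  by (rule sum.reindex_bij_witness[of _ "\<lambda>(a, b). (a + c, b + c)" "\<lambda>(a, b). (a - c, b - c)"])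
    (auto simp: inversions_def shift_def)

text \<open>An inversion (a, b) turns into (-1 - b, -1 - a): bead and hole exchange roles, while
  their order and distance survive.\<close>

lemma maya_hooks_dual: "maya_hooks (dual S) = maya_hooks S"
  unfolding maya_hooks_def
  by (rule sum.reindex_bij_witness[of _ "\<lambda>(a, b). (- 1 - b, - 1 - a)" "\<lambda>(a, b). (- 1 - b, - 1 - a)"])
    (auto simp: inversions_def dual_def)

text \<open>A box is matched with the bead of its row and the hole of its column. The bead lies
  above the hole exactly when the box is in the diagram, and their distance is then the hook
  length.\<close>

lemma bij_betw_diagram_inversions:
  assumes "\<mu> \<in> partitions"
  shows "bij_betw (\<lambda>(i, j). (int (part \<mu> i) - int i, int j - 1 - int (part (conjugate \<mu>) j)))
    (diagram \<mu>) (inversions (beads \<mu>))"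
proof (rule bij_betwI')
  fix p q assume pq: "p \<in> diagram \<mu>" "q \<in> diagram \<mu>"
  obtain i j i' j' where [simp]: "p = (i, j)" "q = (i', j')"
    by force
  have 1: "i = i'" if "int (part \<mu> i) - int i = int (part \<mu> i') - int i'"
    using part_antimono[OF assms, of i i'] part_antimono[OF assms, of i' i] that pq
    by (cases i i' rule: linorder_cases) (auto simp: diagram_def)
  have 2: "j = j'" if "int j - int (part (conjugate \<mu>) j) = int j' - int (part (conjugate \<mu>) j')"
    using part_antimono[OF conjugate_partitions[OF assms], of j j']
      part_antimono[OF conjugate_partitions[OF assms], of j' j] that pq
    by (cases j j' rule: linorder_cases) (auto simp: diagram_def)
  show "((case p of (i, j) \<Rightarrow> (int (part \<mu> i) - int i, int j - 1 - int (part (conjugate \<mu>) j))) =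
      (case q of (i, j) \<Rightarrow> (int (part \<mu> i) - int i, int j - 1 - int (part (conjugate \<mu>) j)))) = (p = q)"
    using 1 2 by auto
next
  fix p assume p: "p \<in> diagram \<mu>"
  obtain i j where [simp]: "p = (i, j)"
    by force
  from p have ij: "1 \<le> i" "1 \<le> j" "j \<le> part \<mu> i"
    by (auto simp: diagram_def)
  then have "i \<le> part (conjugate \<mu>) j"
    by (simp add: le_part_conjugate[OF assms])
  moreover have "int (part \<mu> i) - int i \<in> beads \<mu>"
    using ij by (auto simp: beads_eq_parts)
  moreover have "int j - 1 - int (part (conjugate \<mu>) j) \<notin> beads \<mu>"
    using ij by (auto simp: not_beads_eq_parts[OF assms])
  ultimately show "(case p of (i, j) \<Rightarrow> (int (part \<mu> i) - int i, int j - 1 - int (part (conjugate \<mu>) j)))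
      \<in> inversions (beads \<mu>)"
    using ij by (simp add: inversions_def)
next
  fix z assume z: "z \<in> inversions (beads \<mu>)"
  obtain a b where ab: "z = (a, b)"
    by force
  with z have "a \<in> beads \<mu>" "b \<notin> beads \<mu>" "b < a"
    by (auto simp: inversions_def)
  then obtain i j where ij: "1 \<le> i" "a = int (part \<mu> i) - int i" "1 \<le> j"
      "b = int j - 1 - int (part (conjugate \<mu>) j)"
    by (auto simp: beads_eq_parts[of a] not_beads_eq_parts[OF assms])
  have "j \<le> part \<mu> i"
  proof (rule ccontr)
    assume "\<not> j \<le> part \<mu> i"
    then show False
      using le_part_conjugate[OF assms ij(1,3)] ij \<open>b < a\<close> by linarith
  qed
  moreover from this have "i \<le> length \<mu>"
    using ij by (auto simp: part_def split: if_splits)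
  ultimately have "(i, j) \<in> diagram \<mu>"
    using ij by (simp add: diagram_def)
  then show "\<exists>p\<in>diagram \<mu>. z = (case p of (i, j) \<Rightarrow> (int (part \<mu> i) - int i, int j - 1 - int (part (conjugate \<mu>) j)))"
    using ij ab by (intro bexI[of _ "(i, j)"]) auto
qed

lemma hooks_eq_maya_hooks:
  assumes "\<mu> \<in> partitions"
  shows "hooks \<mu> = maya_hooks (beads \<mu>)"
proof -
  have "hooks \<mu> = (\<Sum>p\<in>diagram \<mu>. {#hook_length \<mu> p#})"
    by (simp add: hooks_def image_mset_mset_set)
  also have "\<dots> = (\<Sum>p\<in>diagram \<mu>.
      (\<lambda>(a, b). {#nat (a - b)#}) ((\<lambda>(i, j). (int (part \<mu> i) - int i, int j - 1 - int (part (conjugate \<mu>) j))) p))"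
  proof (rule sum.cong[OF refl])
    fix p assume p: "p \<in> diagram \<mu>"
    obtain i j where [simp]: "p = (i, j)"
      by force
    from p have ij: "1 \<le> i" "1 \<le> j" "j \<le> part \<mu> i"
      by (auto simp: diagram_def)
    then have "i \<le> part (conjugate \<mu>) j"
      by (simp add: le_part_conjugate[OF assms])
    then have "int (hook_length \<mu> p) = int (part \<mu> i) - int i - (int j - 1 - int (part (conjugate \<mu>) j))"
      using ij by (simp add: hook_length_def)
    then show "{#hook_length \<mu> p#} = (\<lambda>(a, b). {#nat (a - b)#})
        ((\<lambda>(i, j). (int (part \<mu> i) - int i, int j - 1 - int (part (conjugate \<mu>) j))) p)"
      by (simp del: diff_diff_eq2)
  qed
  also have "\<dots> = maya_hooks (beads \<mu>)"
    unfolding maya_hooks_def by (rule sum.reindex_bij_betw[OF bij_betw_diagram_inversions[OF assms]])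
  finally show ?thesis .
qed

section \<open>Self-conjugate bead sets\<close>

lemma charge_dual: "charge (dual S) = - charge S"
  by (simp add: wcharge_dual)

text \<open>Duality negates the charge, so a self-dual set has charge 0 and comes from a partition
  without any shift.\<close>

lemma bij_betw_beads_self_conjugate:
  "bij_betw beads self_conjugate_partitions {S. maya S \<and> dual S = S}"
proof (rule bij_betw_imageI)
  show "inj_on beads self_conjugate_partitions"
    by (auto simp: inj_on_def self_conjugate_iff beads_inject)
  show "beads ` self_conjugate_partitions = {S. maya S \<and> dual S = S}"
  proof (intro set_eqI iffI)
    fix S assume "S \<in> beads ` self_conjugate_partitions"
    then show "S \<in> {S. maya S \<and> dual S = S}"
      by (auto simp: self_conjugate_iff maya_beads)
  next
    fix S assume "S \<in> {S. maya S \<and> dual S = S}"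
    then have S: "maya S" "dual S = S"
      by auto
    from S(1) obtain c \<mu> where \<mu>: "\<mu> \<in> partitions" "S = shift c (beads \<mu>)"
      by (rule maya_eq_shift_beads)
    have "charge S = 0"
      using charge_dual[of S] S(2) by simp
    then have "c = 0"
      using \<mu> by (simp add: charge_shift maya_beads charge_beads)
    then have "S = beads \<mu>"
      using \<mu> by simp
    then show "S \<in> beads ` self_conjugate_partitions"
      using \<mu> S by (intro rev_image_eqI[of \<mu>]) (simp_all add: self_conjugate_iff)
  qed
qed

section \<open>Residue classes as runners of an abacus\<close>

definition runner :: "nat \<Rightarrow> nat \<Rightarrow> int set \<Rightarrow> int set" where
  "runner t r S = {k. k * int t + int r \<in> S}"

lemma bij_betw_runner:
  assumes "0 < t"
  shows "bij_betw (\<lambda>(r, k). k * int t + int r) (SIGMA r:{..<t}. runner t r S) S"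
proof (rule bij_betw_byWitness[where f' = "\<lambda>y. (nat (y mod int t), y div int t)"])
  show "\<forall>p\<in>SIGMA r:{..<t}. runner t r S.
      (\<lambda>y. (nat (y mod int t), y div int t)) (case p of (r, k) \<Rightarrow> k * int t + int r) = p"
    by auto
  show "\<forall>y\<in>S. (case (nat (y mod int t), y div int t) of (r, k) \<Rightarrow> k * int t + int r) = y"
    using assms by simp
  show "(\<lambda>(r, k). k * int t + int r) ` (SIGMA r:{..<t}. runner t r S) \<subseteq> S"
    by (auto simp: runner_def)
  show "(\<lambda>y. (nat (y mod int t), y div int t)) ` S \<subseteq> (SIGMA r:{..<t}. runner t r S)"
    using assms by (auto simp: runner_def nat_less_iff)
qed

text \<open>The cutoff at 0 on the line is the cutoff at 0 on every runner. This is why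
  \<open>maya\<close> and \<open>wcharge\<close> split over the runners.\<close>

lemma runner_pos_iff: "r < t \<Longrightarrow> 0 \<le> k * int t + int r \<longleftrightarrow> 0 \<le> k"
proof
  assume r: "r < t" and *: "0 \<le> k * int t + int r"
  show "0 \<le> k"
  proof (rule ccontr)
    assume "\<not> 0 \<le> k"
    then have "k * int t \<le> - 1 * int t"
      by (intro mult_right_mono) auto
    with * r show False
      by simp
  qed
qed simp

lemma runner_nonneg: "r < t \<Longrightarrow> runner t r (S \<inter> {0..}) = runner t r S \<inter> {0..}"
  by (auto simp: runner_def runner_pos_iff)

lemma runner_neg: "r < t \<Longrightarrow> runner t r ({..<0} - S) = {..<0} - runner t r S"
  by (auto simp: runner_def runner_pos_iff not_le[symmetric] simp del: not_le)

lemma finite_iff_runners: "0 < t \<Longrightarrow> finite S \<longleftrightarrow> (\<forall>r<t. finite (runner t r S))"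
proof
  assume "finite S"
  moreover have "inj (\<lambda>k. k * int t + int r)" if "0 < t" for r
    using that by (auto simp: inj_def)
  ultimately show "\<forall>r<t. finite (runner t r S)" if "0 < t"
    using that finite_vimageI[of S] by (auto simp: runner_def vimage_def)
next
  assume "0 < t" "\<forall>r<t. finite (runner t r S)"
  then have "finite (SIGMA r:{..<t}. runner t r S)"
    by (intro finite_SigmaI) auto
  then show "finite S"
    using bij_betw_finite[OF bij_betw_runner, of t S] \<open>0 < t\<close> by simp
qed

lemma maya_iff_runners: "0 < t \<Longrightarrow> maya S \<longleftrightarrow> (\<forall>r<t. maya (runner t r S))"
  by (auto simp: maya_def finite_iff_runners[of t "S \<inter> {0..}"] finite_iff_runners[of t "{..<0} - S"]
      runner_nonneg runner_neg)

lemma wcharge_runners: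
  assumes "0 < t" "maya S"
  shows "wcharge w S = (\<Sum>r<t. wcharge (\<lambda>k. w (k * int t + int r)) (runner t r S))"
proof -
  have *: "sum w X = (\<Sum>r<t. \<Sum>k\<in>runner t r X. w (k * int t + int r))" if "finite X" for X
  proof -
    have "sum w X = (\<Sum>(r, k)\<in>(SIGMA r:{..<t}. runner t r X). w (k * int t + int r))"
      using sum.reindex_bij_betw[OF bij_betw_runner[OF assms(1)], of w X]
      by (simp add: split_def)
    also have "\<dots> = (\<Sum>r<t. \<Sum>k\<in>runner t r X. w (k * int t + int r))"
      using that finite_iff_runners[OF assms(1), of X] by (intro sum.Sigma[symmetric]) auto
    finally show ?thesis .
  qed
  have "finite (S \<inter> {0..})" "finite ({..<0} - S)"
    using assms(2) by (auto simp: maya_def)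
  then show ?thesis
    by (simp add: wcharge_def * sum_subtractf runner_nonneg runner_neg)
qed

lemma runner_dual:
  assumes "r < t"
  shows "runner t (t - 1 - r) (dual S) = dual (runner t r S)"
proof -
  have "- 1 - (k * int t + int (t - 1 - r)) = (- 1 - k) * int t + int r" for k
    using assms by (simp add: of_nat_diff algebra_simps)
  then show ?thesis
    by (simp add: runner_def dual_def)
qed

lemma image_mset_maya_hooks:
  assumes "maya S"
  shows "image_mset f (maya_hooks S) = (\<Sum>(a, b)\<in>inversions S. {#f (nat (a - b))#})"
proof -
  have "maya_hooks S = image_mset (\<lambda>(a, b). nat (a - b)) (mset_set (inversions S))"
    using finite_inversions[OF assms]
    by (simp add: maya_hooks_def image_mset_mset_set case_prod_unfold)
  then have "image_mset f (maya_hooks S) =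
      image_mset (\<lambda>(a, b). f (nat (a - b))) (mset_set (inversions S))"
    by (simp add: multiset.map_comp o_def case_prod_unfold)
  then show ?thesis
    using finite_inversions[OF assms] by (simp add: image_mset_mset_set case_prod_unfold)
qed

text \<open>A bead and a hole whose distance is divisible by \<open>t\<close> lie on the same
  runner, where their distance is \<open>t\<close> times smaller. The reindexing sends a position to
  its remainder and quotient.\<close>

lemma filter_mset_maya_hooks:
  assumes "maya S" "0 < t"
  shows "filter_mset (\<lambda>h. t dvd h) (maya_hooks S) =
    (\<Sum>r<t. image_mset ((*) t) (maya_hooks (runner t r S)))"
proof -
  let ?A = "{(a, b) \<in> inversions S. t dvd nat (a - b)}"
  let ?B = "SIGMA r:{..<t}. inversions (runner t r S)"
  have maya: "maya (runner t r S)" if "r < t" for r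
    using maya_iff_runners[OF assms(2)] assms(1) that by blast
  have "maya_hooks S = image_mset (\<lambda>(a, b). nat (a - b)) (mset_set (inversions S))"
    using finite_inversions[OF assms(1)]
    by (simp add: maya_hooks_def image_mset_mset_set case_prod_unfold)
  then have "filter_mset (\<lambda>h. t dvd h) (maya_hooks S) =
      image_mset (\<lambda>(a, b). nat (a - b)) (mset_set ?A)"
    using finite_inversions[OF assms(1)]
    by (simp add: filter_mset_image_mset case_prod_unfold)
  also have "\<dots> = (\<Sum>(a, b)\<in>?A. {#nat (a - b)#})"
    using finite_subset[OF _ finite_inversions[OF assms(1)], of ?A]
    by (simp add: image_mset_mset_set case_prod_unfold)
  also have "\<dots> = (\<Sum>(r, k, l)\<in>?B. {#t * nat (k - l)#})"
  proof (rule sum.reindex_bij_witness[of _ "\<lambda>(r, k, l). (k * int t + int r, l * int t + int r)"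
      "\<lambda>(a, b). (nat (a mod int t), a div int t, b div int t)"], goal_cases)
    case (1 p)
    obtain a b where p: "p = (a, b)"
      by force
    with 1 have ab: "a \<in> S" "b \<notin> S" "b < a" "t dvd nat (a - b)"
      by (auto simp: inversions_def)
    then have "int t dvd a - b"
      by (metis diff_ge_0_iff_ge int_dvd_int_iff int_nat_eq less_imp_le)
    then have "a mod int t = b mod int t"
      by (simp add: mod_eq_dvd_iff)
    then show ?case
      using assms(2) p by simp (metis div_mult_mod_eq)
  next
    case (2 p)
    obtain a b where p: "p = (a, b)"
      by force
    with 2 have ab: "a \<in> S" "b \<notin> S" "b < a" "t dvd nat (a - b)"
      by (auto simp: inversions_def)
    then have "int t dvd a - b"
      by (metis diff_ge_0_iff_ge int_dvd_int_iff int_nat_eq less_imp_le)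
    then have mod: "a mod int t = b mod int t"
      by (simp add: mod_eq_dvd_iff)
    have a: "a div int t * int t + a mod int t = a" and b: "b div int t * int t + a mod int t = b"
      by (simp, metis mod div_mult_mod_eq)
    have "b div int t * int t < a div int t * int t"
      using a b ab(3) by linarith
    then have "b div int t < a div int t"
      using assms(2) by simp
    then show ?case
      using assms(2) ab a b p by (simp add: inversions_def runner_def nat_less_iff)
  next
    case (3 p)
    then show ?case
      using assms(2) by (auto simp: inversions_def runner_def)
  next
    case (4 p)
    obtain r k l where p: "p = (r, k, l)"
      by (cases p) auto
    with 4 have *: "r < t" "k * int t + int r \<in> S" "l * int t + int r \<notin> S" "l < k"
      by (auto simp: inversions_def runner_def)
    have "k * int t + int r - (l * int t + int r) = int t * (k - l)"
      by (simp add: algebra_simps)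
    then have "nat (k * int t + int r - (l * int t + int r)) = t * nat (k - l)"
      using *(4) by (simp only: nat_mult_distrib) (simp add: nat_mult_distrib)
    then show ?case
      using * p assms(2) by (simp add: inversions_def)
  next
    case (5 p)
    obtain a b where p: "p = (a, b)"
      by force
    with 5 have ab: "b < a" "t dvd nat (a - b)"
      by (auto simp: inversions_def)
    then have "int t dvd a - b"
      by (metis diff_ge_0_iff_ge int_dvd_int_iff int_nat_eq less_imp_le)
    then obtain d where d: "a = b + int t * d"
      by (metis add.commute diff_add_cancel dvdE)
    with ab have "0 < d"
      using assms(2) by (simp add: zero_less_mult_iff)
    then have "nat (a - b) = t * nat (a div int t - b div int t)"
      using assms(2) by (simp add: d nat_mult_distrib)
    then show ?case
      by (simp add: p)
  qed
  also have "\<dots> = (\<Sum>r<t. \<Sum>(k, l)\<in>inversions (runner t r S). {#t * nat (k - l)#})"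
    using finite_inversions maya
    by (subst sum.Sigma) (auto simp: case_prod_unfold)
  also have "\<dots> = (\<Sum>r<t. image_mset ((*) t) (maya_hooks (runner t r S)))"
    using maya by (intro sum.cong) (auto simp: image_mset_maya_hooks)
  finally show ?thesis .
qed

lemma sum_lessThan_double:
  fixes g :: "nat \<Rightarrow> 'a::comm_monoid_add"
  shows "(\<Sum>r<2 * m. g r) = (\<Sum>r<m. g r + g (2 * m - 1 - r))"
proof -
  have "{..<2 * m} = {..<m} \<union> {m..<2 * m}"
    by auto
  then have "(\<Sum>r<2 * m. g r) = (\<Sum>r<m. g r) + (\<Sum>r\<in>{m..<2 * m}. g r)"
    by (simp add: sum.union_disjoint ivl_disj_int)
  also have "(\<Sum>r\<in>{m..<2 * m}. g r) = (\<Sum>r<m. g (2 * m - 1 - r))"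
    by (rule sum.reindex_bij_witness[of _ "\<lambda>r. 2 * m - 1 - r" "\<lambda>r. 2 * m - 1 - r"]) auto
  finally show ?thesis
    by (simp add: sum.distrib)
qed

text \<open>Runner 2m - 1 - r is the dual of runner r, so it contributes the reflected weight with
  the opposite sign.\<close>

lemma wcharge_self_dual_runners:
  assumes "maya S" "dual S = S" "0 < m"
  shows "wcharge w S = (\<Sum>r<m. wcharge (\<lambda>k. w (k * int (2 * m) + int r)
    - w (- 1 - (k * int (2 * m) + int r))) (runner (2 * m) r S))"
proof -
  let ?t = "2 * m"
  have "wcharge w S = (\<Sum>r<?t. wcharge (\<lambda>k. w (k * int ?t + int r)) (runner ?t r S))"
    using assms by (intro wcharge_runners) auto
  also have "\<dots> = (\<Sum>r<m. wcharge (\<lambda>k. w (k * int ?t + int r)) (runner ?t r S) +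
      wcharge (\<lambda>k. w (k * int ?t + int (?t - 1 - r))) (runner ?t (?t - 1 - r) S))"
    by (rule sum_lessThan_double)
  also have "\<dots> = (\<Sum>r<m. wcharge (\<lambda>k. w (k * int ?t + int r)
      - w (- 1 - (k * int ?t + int r))) (runner ?t r S))"
  proof (rule sum.cong[OF refl])
    fix r assume "r \<in> {..<m}"
    then have r: "r < ?t"
      by simp
    have "(- 1 - k) * int ?t + int (?t - 1 - r) = - 1 - (k * int ?t + int r)" for k
      using r by (simp add: of_nat_diff algebra_simps)
    then have "wcharge (\<lambda>k. w (k * int ?t + int (?t - 1 - r))) (runner ?t (?t - 1 - r) S) =
        - wcharge (\<lambda>k. w (- 1 - (k * int ?t + int r))) (runner ?t r S)"
      using runner_dual[OF r, of S] unfolding assms(2) by (simp only: wcharge_dual)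
    then show "wcharge (\<lambda>k. w (k * int ?t + int r)) (runner ?t r S) +
        wcharge (\<lambda>k. w (k * int ?t + int (?t - 1 - r))) (runner ?t (?t - 1 - r) S) =
        wcharge (\<lambda>k. w (k * int ?t + int r) - w (- 1 - (k * int ?t + int r))) (runner ?t r S)"
      by (simp only: wcharge_diff add_uminus_conv_diff)
  qed
  finally show ?thesis .
qed

lemma parity_reflect:
  "(if even y then 1 else 0) - (if even (- 1 - y) then 1 else 0) = (if even y then 1 else (- 1 :: int))"
  for y :: int
proof -
  have "even (- 1 - y) \<longleftrightarrow> odd y"
    by presburger
  then show ?thesis
    by simp
qed

text \<open>The weight y becomes y - (-1 - y) = 2y + 1, and at y = 2mk + r this is 4mk + (2r + 1), a
  combination of energy and charge.\<close>

lemma sum_list_self_conjugate: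
  assumes "\<mu> \<in> self_conjugate_partitions" "0 < m"
  shows "int (sum_list \<mu>) = (\<Sum>r<m. 4 * int m * energy (runner (2 * m) r (beads \<mu>))
    + (2 * int r + 1) * charge (runner (2 * m) r (beads \<mu>)))"
proof -
  have \<mu>: "\<mu> \<in> partitions" "dual (beads \<mu>) = beads \<mu>"
    using assms by (auto simp: self_conjugate_iff)
  have eq: "k * int (2 * m) + int r - (- 1 - (k * int (2 * m) + int r)) =
      4 * int m * k + (2 * int r + 1)" for k r
    by (simp add: algebra_simps)
  show ?thesis
    using wcharge_self_dual_runners[OF maya_beads \<mu>(2) assms(2), of "\<lambda>y. y"]
    unfolding eq wcharge_affine energy_beads[OF \<mu>(1)] .
qed

text \<open>The parity indicator becomes the sign (-1)^y, which equals (-1)^r on all of runner r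
  because the modulus is even.\<close>

lemma BG_rank_self_conjugate:
  assumes "\<mu> \<in> self_conjugate_partitions" "0 < m"
  shows "BG_rank \<mu> = (\<Sum>r<m. (- 1) ^ r * charge (runner (2 * m) r (beads \<mu>)))"
proof -
  have \<mu>: "\<mu> \<in> partitions" "dual (beads \<mu>) = beads \<mu>"
    using assms by (auto simp: self_conjugate_iff)
  have eq: "(if even (k * int (2 * m) + int r) then 1 else (- 1 :: int)) = (- 1) ^ r" for k r
    by simp
  show ?thesis
    using wcharge_self_dual_runners[OF maya_beads \<mu>(2) assms(2), of "\<lambda>y. if even y then 1 else 0"]
    unfolding parity_reflect eq wcharge_const[of "(- 1) ^ _"] BG_rank_eq_wcharge[OF \<mu>(1)] .
qed

lemma hooks_div_self_conjugate:
  assumes "\<mu> \<in> self_conjugate_partitions" "0 < m"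
  shows "hooks_div (2 * m) \<mu> = (\<Sum>r<m. image_mset ((*) (2 * m))
    (maya_hooks (runner (2 * m) r (beads \<mu>)) + maya_hooks (runner (2 * m) r (beads \<mu>))))"
proof -
  let ?t = "2 * m"
  have \<mu>: "\<mu> \<in> partitions" "dual (beads \<mu>) = beads \<mu>"
    using assms by (auto simp: self_conjugate_iff)
  have "maya_hooks (runner ?t (?t - 1 - r) (beads \<mu>)) = maya_hooks (runner ?t r (beads \<mu>))"
    if "r < m" for r
    using runner_dual[of r ?t "beads \<mu>"] that unfolding \<mu>(2) by (simp add: maya_hooks_dual)
  then show ?thesis
    unfolding hooks_div_def hooks_eq_maya_hooks[OF \<mu>(1)]
    using assms(2) by (simp add: filter_mset_maya_hooks maya_beads sum_lessThan_double)
qed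

lemma bij_betw_self_conjugate_runners:
  assumes "0 < m"
  shows "bij_betw (\<lambda>\<mu>. \<lambda>r\<in>{..<m}. runner (2 * m) r (beads \<mu>)) self_conjugate_partitions
    (PiE {..<m} (\<lambda>_. Collect maya))"
proof -
  let ?t = "2 * m"
  have "bij_betw (\<lambda>S. \<lambda>r\<in>{..<m}. runner ?t r S) {S. maya S \<and> dual S = S}
      (PiE {..<m} (\<lambda>_. Collect maya))"
  proof (rule bij_betwI')
    fix S T assume "S \<in> {S. maya S \<and> dual S = S}" "T \<in> {S. maya S \<and> dual S = S}"
    then have dual: "dual S = S" "dual T = T"
      by auto
    show "((\<lambda>r\<in>{..<m}. runner ?t r S) = (\<lambda>r\<in>{..<m}. runner ?t r T)) = (S = T)"
    proof
      assume "(\<lambda>r\<in>{..<m}. runner ?t r S) = (\<lambda>r\<in>{..<m}. runner ?t r T)"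
      then have low: "runner ?t r S = runner ?t r T" if "r < m" for r
        using that by (metis lessThan_iff restrict_apply')
      have all: "runner ?t r S = runner ?t r T" if "r < ?t" for r
      proof (cases "r < m")
        case False
        then have "?t - 1 - r < m" "?t - 1 - (?t - 1 - r) = r"
          using that by auto
        then show ?thesis
          using runner_dual[of "?t - 1 - r" ?t S] runner_dual[of "?t - 1 - r" ?t T] low dual by simp
      qed (rule low)
      have "y \<in> S \<longleftrightarrow> y \<in> T" for y
      proof -
        have "nat (y mod int ?t) < ?t"
          using assms by (simp add: nat_less_iff)
        from all[OF this] have "y div int ?t \<in> runner ?t (nat (y mod int ?t)) S \<longleftrightarrow>
            y div int ?t \<in> runner ?t (nat (y mod int ?t)) T"
          by (simp only:)
        then show ?thesis
          using assms by (simp add: runner_def div_mult_mod_eq)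
      qed
      then show "S = T"
        by blast
    qed simp
  next
    fix S assume "S \<in> {S. maya S \<and> dual S = S}"
    then show "(\<lambda>r\<in>{..<m}. runner ?t r S) \<in> PiE {..<m} (\<lambda>_. Collect maya)"
      using maya_iff_runners[of ?t S] assms by auto
  next
    fix X assume X: "X \<in> PiE {..<m} (\<lambda>_. Collect maya)"
    \<comment> \<open>The upper runners are forced by \<open>runner_dual\<close>; \<open>S\<close>
      reassembles all of them.\<close>
    define Y where "Y r = (if r < m then X r else dual (X (?t - 1 - r)))" for r
    define S where "S = {y. y div int ?t \<in> Y (nat (y mod int ?t))}"
    have runner: "runner ?t r S = Y r" if "r < ?t" for r
      using that by (auto simp: runner_def S_def)
    have "maya (Y r)" if "r < ?t" for r
      using X that by (auto simp: Y_def PiE_iff intro!: maya_dual)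
    then have "maya S"
      using maya_iff_runners[of ?t S] assms runner by simp
    moreover have "dual S = S"
    proof -
      have "y \<in> dual S \<longleftrightarrow> y \<in> S" for y
      proof -
        define r where "r = nat (y mod int ?t)"
        have r: "r < ?t" "int r = y mod int ?t"
          using assms by (auto simp: r_def nat_less_iff)
        have y: "y = y div int ?t * int ?t + int r"
          by (simp add: r div_mult_mod_eq)
        \<comment> \<open>Writing r as the mirror image of its mirror image brings the index into
          the form of \<open>runner_dual\<close>.\<close>
        have "y \<in> dual S \<longleftrightarrow> y div int ?t \<in> runner ?t (?t - 1 - (?t - 1 - r)) (dual S)"
        proof -
          have "?t - 1 - (?t - 1 - r) = r"
            using r(1) by simp
          then show ?thesis
            by (simp only: runner_def mem_Collect_eq y[symmetric])
        qed
        also have "\<dots> \<longleftrightarrow> y div int ?t \<in> dual (Y (?t - 1 - r))"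
          using r(1) by (subst runner_dual) (simp_all add: runner)
        also have "dual (Y (?t - 1 - r)) = Y r"
          using r(1) by (auto simp: Y_def)
        also have "y div int ?t \<in> Y r \<longleftrightarrow> y \<in> S"
          by (simp add: S_def r_def)
        finally show ?thesis .
      qed
      then show ?thesis
        by blast
    qed
    moreover have "X = (\<lambda>r\<in>{..<m}. runner ?t r S)"
    proof (rule ext)
      fix r show "X r = (\<lambda>r\<in>{..<m}. runner ?t r S) r"
        using X runner[of r] by (cases "r < m") (auto simp: Y_def PiE_iff extensional_def)
    qed
    ultimately show "\<exists>S\<in>{S. maya S \<and> dual S = S}. X = (\<lambda>r\<in>{..<m}. runner ?t r S)"
      by blast
  qed
  from bij_betw_trans[OF bij_betw_beads_self_conjugate this] show ?thesis
    by (simp add: o_def)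
qed

section \<open>Self-dual sets through their nonnegative beads\<close>

lemma wcharge_self_dual:
  assumes "dual S = S"
  shows "wcharge w S = (\<Sum>y\<in>S \<inter> {0..}. w y - w (- 1 - y))"
proof -
  have "sum w ({..<0} - S) = (\<Sum>y\<in>S \<inter> {0..}. w (- 1 - y))"
    using dual_neg[of S] assms by (simp add: sum.reindex inj_on_def)
  then show ?thesis
    by (simp add: wcharge_def sum_subtractf)
qed

text \<open>A negative y belongs to a self-dual set exactly when -1 - y does not, so the nonnegative
  beads determine the rest and may be any finite set. Bead a stands for a diagonal hook of length 2a
  + 1.\<close>

lemma bij_betw_self_conjugate_Fpow:
  "bij_betw (\<lambda>\<mu>. nat ` (beads \<mu> \<inter> {0..})) self_conjugate_partitions {A. finite A}"
proof -
  have "bij_betw (\<lambda>S. nat ` (S \<inter> {0..})) {S. maya S \<and> dual S = S} {A. finite A}"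
  proof (rule bij_betw_byWitness[where
        f' = "\<lambda>A. {y. if 0 \<le> y then nat y \<in> A else nat (- 1 - y) \<notin> A}"])
    show "\<forall>S\<in>{S. maya S \<and> dual S = S}.
        {y. if 0 \<le> y then nat y \<in> nat ` (S \<inter> {0..}) else nat (- 1 - y) \<notin> nat ` (S \<inter> {0..})} = S"
    proof
      fix S assume "S \<in> {S. maya S \<and> dual S = S}"
      then have S: "y \<in> S \<longleftrightarrow> - 1 - y \<notin> S" for y
        by (auto simp: dual_def)
      have nat: "nat y \<in> nat ` (S \<inter> {0..}) \<longleftrightarrow> y \<in> S" if "0 \<le> y" for y
        using that by (auto simp: image_iff eq_nat_nat_iff)
      have "(if 0 \<le> y then nat y \<in> nat ` (S \<inter> {0..}) else nat (- 1 - y) \<notin> nat ` (S \<inter> {0..}))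
          \<longleftrightarrow> y \<in> S" for y
      proof (cases "0 \<le> y")
        case True
        then show ?thesis
          by (simp only: if_True nat[OF True])
      next
        case False
        then have "0 \<le> - 1 - y"
          by simp
        from nat[OF this] show ?thesis
          using S[of y] by (simp only: False if_False)
      qed
      then show "{y. if 0 \<le> y then nat y \<in> nat ` (S \<inter> {0..})
          else nat (- 1 - y) \<notin> nat ` (S \<inter> {0..})} = S"
        by blast
    qed
    show "\<forall>A\<in>{A. finite A}.
        nat ` ({y. if 0 \<le> y then nat y \<in> A else nat (- 1 - y) \<notin> A} \<inter> {0..}) = A"
    proof
      fix A :: "nat set"
      have "{y. if 0 \<le> y then nat y \<in> A else nat (- 1 - y) \<notin> A} \<inter> {0..} = int ` A"
      proof (intro set_eqI iffI)
        fix y assume "y \<in> {y. if 0 \<le> y then nat y \<in> A else nat (- 1 - y) \<notin> A} \<inter> {0..}"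
        then show "y \<in> int ` A"
          by (intro rev_image_eqI[of "nat y"]) auto
      qed auto
      then show "nat ` ({y. if 0 \<le> y then nat y \<in> A else nat (- 1 - y) \<notin> A} \<inter> {0..}) = A"
        by (simp add: image_image)
    qed
    show "(\<lambda>S. nat ` (S \<inter> {0..})) ` {S. maya S \<and> dual S = S} \<subseteq> {A. finite A}"
      by (auto simp: maya_def)
    show "(\<lambda>A. {y. if 0 \<le> y then nat y \<in> A else nat (- 1 - y) \<notin> A}) ` {A. finite A}
        \<subseteq> {S. maya S \<and> dual S = S}"
    proof
      fix S assume "S \<in> (\<lambda>A. {y. if 0 \<le> y then nat y \<in> A else nat (- 1 - y) \<notin> A}) ` {A. finite A}"
      then obtain A where A: "finite A" "S = {y. if 0 \<le> y then nat y \<in> A else nat (- 1 - y) \<notin> A}"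
        by blast
      have "S \<inter> {0..} \<subseteq> int ` A" "{..<0} - S \<subseteq> (\<lambda>a. - 1 - int a) ` A"
      proof -
        show "S \<inter> {0..} \<subseteq> int ` A"
        proof
          fix y assume "y \<in> S \<inter> {0..}"
          then show "y \<in> int ` A"
            by (intro rev_image_eqI[of "nat y"]) (auto simp: A(2))
        qed
        show "{..<0} - S \<subseteq> (\<lambda>a. - 1 - int a) ` A"
        proof
          fix y assume "y \<in> {..<0} - S"
          then show "y \<in> (\<lambda>a. - 1 - int a) ` A"
            by (intro rev_image_eqI[of "nat (- 1 - y)"]) (auto simp: A(2))
        qed
      qed
      then have "maya S"
        using A(1) by (meson finite_imageI finite_subset maya_def)
      moreover have "dual S = S"
        unfolding A(2) by (auto simp: dual_def)
      ultimately show "S \<in> {S. maya S \<and> dual S = S}"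
        by simp
    qed
  qed
  from bij_betw_trans[OF bij_betw_beads_self_conjugate this] show ?thesis
    by (simp add: o_def)
qed

lemma wcharge_beads_self_conjugate:
  assumes "\<mu> \<in> self_conjugate_partitions"
  shows "wcharge w (beads \<mu>) = (\<Sum>a\<in>nat ` (beads \<mu> \<inter> {0..}). w (int a) - w (- 1 - int a))"
  using assms by (subst sum.reindex) (auto simp: inj_on_def self_conjugate_iff wcharge_self_dual)

lemma sum_list_eq_sum_Fpow:
  assumes "\<mu> \<in> self_conjugate_partitions"
  shows "sum_list \<mu> = (\<Sum>a\<in>nat ` (beads \<mu> \<inter> {0..}). 2 * a + 1)"
proof -
  have "int (sum_list \<mu>) = (\<Sum>a\<in>nat ` (beads \<mu> \<inter> {0..}). int a - (- 1 - int a))"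
    using wcharge_beads_self_conjugate[OF assms, of "\<lambda>y. y"] assms
    by (simp add: self_conjugate_iff energy_beads)
  also have "\<dots> = int (\<Sum>a\<in>nat ` (beads \<mu> \<inter> {0..}). 2 * a + 1)"
    unfolding of_nat_sum by (rule sum.cong) auto
  finally show ?thesis
    by (simp only: of_nat_eq_iff)
qed

lemma BG_rank_eq_sum_Fpow:
  assumes "\<mu> \<in> self_conjugate_partitions"
  shows "BG_rank \<mu> = (\<Sum>a\<in>nat ` (beads \<mu> \<inter> {0..}). (- 1) ^ a)"
proof -
  have "(if even (int a) then 1 else (- 1 :: int)) = (- 1) ^ a" for a
    by simp
  then show ?thesis
    using wcharge_beads_self_conjugate[OF assms, of "\<lambda>y. if even y then 1 else 0"] assms
    unfolding parity_reflect by (simp add: self_conjugate_iff BG_rank_eq_wcharge)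
qed

section \<open>Generating functions\<close>

lemma length_le_sum_list: "\<nu> \<in> partitions \<Longrightarrow> length \<nu> \<le> sum_list \<nu>"
  by (induction \<nu>) (auto simp: partitions_Cons)

lemma finite_partitions_le: "finite {\<nu> \<in> partitions. sum_list \<nu> \<le> n}"
proof (rule finite_subset)
  show "{\<nu> \<in> partitions. sum_list \<nu> \<le> n} \<subseteq> {\<nu>. set \<nu> \<subseteq> {..n} \<and> length \<nu> \<le> n}"
    using length_le_sum_list member_le_sum_list by (fastforce intro: order_trans)
qed (simp add: finite_lists_length_le)

lemma locally_finite_partitions:
  assumes "0 < s" "\<And>\<nu> n. \<nu> \<in> partitions \<Longrightarrow> n < s * sum_list \<nu> \<Longrightarrow> fps_nth (f \<nu>) n = 0"
  shows "locally_finite f partitions"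
proof (rule locally_finite_subdegree[of _ "\<lambda>\<nu>. s * sum_list \<nu>"])
  fix n
  have "k \<le> s * k" for k
    using assms(1) by (cases s) auto
  then have "{\<nu> \<in> partitions. s * sum_list \<nu> \<le> n} \<subseteq> {\<nu> \<in> partitions. sum_list \<nu> \<le> n}"
    using le_trans by blast
  then show "finite {\<nu> \<in> partitions. s * sum_list \<nu> \<le> n}"
    using finite_partitions_le by (rule finite_subset)
qed (fact assms(2))

lemma locally_finite_X_power_partitions:
  "0 < s \<Longrightarrow> locally_finite (\<lambda>\<nu>. fps_X ^ (s * sum_list \<nu>) * (v \<nu> :: 'a::comm_ring_1 fps)) partitions"
  by (rule locally_finite_partitions) (use eq_upto_X_power_mult in \<open>auto simp: eq_upto_def\<close>)

text \<open>
  Partitions with parts at most \<open>N + 1\<close> either have parts at most \<open>N\<close> or start with a part \<open>N + 1\<close>,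
  so their generating functions are built up factor by factor.
\<close>

lemma infsum_partitions_times_qpochhammer:
  assumes "0 < s"
  shows "(\<Sum>\<^sub>\<infinity>\<nu>\<in>partitions. fps_X ^ (s * sum_list \<nu>)) *
    qpochhammer_inf (fps_X ^ s) (fps_X ^ s) = (1 :: 'a::idom fps)"
proof -
  define w :: "nat list \<Rightarrow> 'a fps" where "w \<nu> = fps_X ^ (s * sum_list \<nu>)" for \<nu>
  define PP where "PP N = {\<nu> \<in> partitions. set \<nu> \<subseteq> {..N}}" for N
  have lf: "locally_finite w partitions"
    using locally_finite_X_power_partitions[OF assms, of "\<lambda>_. 1"] by (simp add: w_def[abs_def])
  have lfN: "locally_finite w (PP N)" for N
    by (rule locally_finite_subset[OF lf]) (auto simp: PP_def)
  have "infsum w (PP (Suc N)) = infsum w (PP N) + fps_X ^ (s * Suc N) * infsum w (PP (Suc N))" for N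
  proof -
    have split: "PP (Suc N) = PP N \<union> (#) (Suc N) ` PP (Suc N)"
    proof (intro set_eqI iffI)
      fix \<nu> assume \<nu>: "\<nu> \<in> PP (Suc N)"
      show "\<nu> \<in> PP N \<union> (#) (Suc N) ` PP (Suc N)"
      proof (cases \<nu>)
        case (Cons x \<nu>')
        show ?thesis
        proof (cases "x = Suc N")
          case True
          then show ?thesis
            using \<nu> Cons by (auto simp: PP_def partitions_Cons)
        next
          case False
          then have "x \<le> N"
            using \<nu> Cons by (auto simp: PP_def)
          then show ?thesis
            using \<nu> Cons by (force simp: PP_def partitions_Cons)
        qed
      qed (simp add: PP_def)
    next
      fix \<nu> assume "\<nu> \<in> PP N \<union> (#) (Suc N) ` PP (Suc N)"
      then show "\<nu> \<in> PP (Suc N)"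
        by (fastforce simp: PP_def partitions_Cons)
    qed
    have disj: "PP N \<inter> (#) (Suc N) ` PP (Suc N) = {}"
      by (auto simp: PP_def)
    have "infsum w ((#) (Suc N) ` PP (Suc N)) = (\<Sum>\<^sub>\<infinity>\<nu>\<in>PP (Suc N). w (Suc N # \<nu>))"
      by (subst infsum_reindex) (auto simp: o_def)
    also have "\<dots> = (\<Sum>\<^sub>\<infinity>\<nu>\<in>PP (Suc N). fps_X ^ (s * Suc N) * w \<nu>)"
      by (simp add: w_def power_add algebra_simps)
    also have "\<dots> = fps_X ^ (s * Suc N) * infsum w (PP (Suc N))"
      by (rule infsum_cmult_fps(2)[OF lfN])
    finally have "infsum w ((#) (Suc N) ` PP (Suc N)) = fps_X ^ (s * Suc N) * infsum w (PP (Suc N))" .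
    then show ?thesis
      using infsum_Un_fps[OF _ disj, of w] lfN[of "Suc N"] unfolding split[symmetric] by simp
  qed
  then have "infsum w (PP (Suc N)) - fps_X ^ (s * Suc N) * infsum w (PP (Suc N)) = infsum w (PP N)" for N
    by (simp only: diff_eq_eq)
  then have step: "infsum w (PP (Suc N)) * (1 - fps_X ^ (s * Suc N)) = infsum w (PP N)" for N
    by (simp only: right_diff_distrib mult_1_left mult_1_right mult.commute)
  have PP: "infsum w (PP N) * (\<Prod>j<N. 1 - fps_X ^ s * fps_X ^ (s * j)) = 1" for N
  proof (induction N)
    case 0
    have "PP 0 = {[]}"
    proof (rule set_eqI)
      fix \<nu> show "\<nu> \<in> PP 0 \<longleftrightarrow> \<nu> \<in> {[]}"
        by (cases \<nu>) (auto simp: PP_def partitions_Cons)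
    qed
    then show ?case
      by (simp add: w_def)
  next
    case (Suc N)
    have "infsum w (PP (Suc N)) * (\<Prod>j<Suc N. 1 - fps_X ^ s * fps_X ^ (s * j)) =
        infsum w (PP (Suc N)) * (1 - fps_X ^ (s * Suc N)) * (\<Prod>j<N. 1 - fps_X ^ s * fps_X ^ (s * j))"
      by (simp only: prod.lessThan_Suc mult_Suc_right power_add mult_ac)
    then show ?case
      using Suc by (simp only: step)
  qed
  have "infsum w partitions * qpochhammer_inf (fps_X ^ s) (fps_X ^ s) = 1"
  proof (rule fps_eq_upto)
    fix n
    \<comment> \<open>A partition of size at most n has no part above n, so \<open>F\<close>
      truncates the sum over all partitions and the sum over \<open>PP n\<close> alike.\<close>
    define F where "F = {\<nu> \<in> partitions. sum_list \<nu> \<le> n}"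
    have F: "finite F" "F \<subseteq> partitions" "F \<subseteq> PP n"
      using finite_partitions_le member_le_sum_list by (fastforce simp: F_def PP_def)+
    have 0: "eq_upto n (w \<nu>) 0" if "\<nu> \<in> partitions - F" for \<nu>
    proof -
      have "n < sum_list \<nu>"
        using that by (auto simp: F_def)
      also have "sum_list \<nu> \<le> s * sum_list \<nu>"
        using assms by (cases s) auto
      finally show ?thesis
        unfolding w_def by (rule eq_upto_X_power)
    qed
    have "PP n \<subseteq> partitions"
      by (auto simp: PP_def)
    then have "eq_upto n (infsum w partitions) (sum w F)" "eq_upto n (infsum w (PP n)) (sum w F)"
      using F 0 by (auto intro!: infsum_eq_upto lf lfN)
    then have "eq_upto n (infsum w partitions) (infsum w (PP n))"
      by (rule eq_upto_join)
    from eq_upto_mult[OF this qpochhammer_eq_upto[of "fps_X ^ s" s n n]] assms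
    show "eq_upto n (infsum w partitions * qpochhammer_inf (fps_X ^ s) (fps_X ^ s)) 1"
      unfolding PP by (simp add: fps_X_power_iff)
  qed
  then show ?thesis
    by (simp add: w_def[abs_def])
qed

text \<open>Expanding the product selects a subset of the \<open>y a\<close>. A subset with an
  element at least N contributes nothing through degree n.\<close>

lemma infsum_finite_subsets:
  fixes y :: "nat \<Rightarrow> 'a::comm_ring_1 fps"
  assumes y: "\<And>a. eq_upto a (y a) 0" and N: "n < N"
  shows "eq_upto n (\<Sum>\<^sub>\<infinity>A\<in>{A. finite A}. \<Prod>a\<in>A. y a) (\<Prod>a<N. 1 + y a)"
proof -
  have 0: "eq_upto n (\<Prod>a\<in>A. y a) 0" if "finite A" "\<not> A \<subseteq> {..<N}" "n < N" for A n N
  proof -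
    from that obtain a where "a \<in> A" "n \<le> a"
      by force
    with that(1) show ?thesis
      by (intro eq_upto_prod_0[of A a]) (auto intro: eq_upto_mono[OF y])
  qed
  have lf: "locally_finite (\<lambda>A. \<Prod>a\<in>A. y a) {A. finite A}"
    unfolding locally_finite_def
  proof
    fix n
    show "finite {A \<in> {A. finite A}. \<not> eq_upto n (\<Prod>a\<in>A. y a) 0}"
      by (rule finite_subset[of _ "Pow {..<Suc n}"]) (use 0[of _ "Suc n" n] in auto)
  qed
  have "eq_upto n (\<Sum>\<^sub>\<infinity>A\<in>{A. finite A}. \<Prod>a\<in>A. y a) (\<Sum>A\<in>Pow {..<N}. \<Prod>a\<in>A. y a)"
    by (rule infsum_eq_upto[OF lf]) (use 0 N in \<open>auto intro: finite_subset\<close>)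
  moreover have "(\<Prod>a<N. y a + 1) = (\<Sum>A\<in>Pow {..<N}. \<Prod>a\<in>A. y a)"
    by (subst prod_add) simp_all
  ultimately show ?thesis
    by (simp add: add.commute)
qed

lemma b_powi_0: "b_powi 0 = 1"
  by (simp add: b_powi_def)

lemma b_powi_add: "b_powi (i + j) = b_powi i * b_powi j"
  by (simp add: b_powi_def fls_X_intpow_times_fls_X_intpow)

lemma b_powi_sum: "b_powi (sum f A) = (\<Prod>a\<in>A. b_powi (f a))"
  by (induction A rule: infinite_finite_induct) (simp_all add: b_powi_0 b_powi_add)

lemma prod_lessThan_double:
  fixes g :: "nat \<Rightarrow> 'a::comm_monoid_mult"
  shows "(\<Prod>a<2 * n. g a) = (\<Prod>k<n. g (2 * k)) * (\<Prod>k<n. g (2 * k + 1))"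
  by (induction n) (simp_all add: mult_ac)

text \<open>Bead a contributes q^(2a+1) b^((-1)^a). Even a = 2j give q^(4j+1) b and odd a = 2j + 1
  give q^(4j+3)/b, which are the two products.\<close>

lemma infsum_self_conjugate_eq_qpochhammer:
  "(\<Sum>\<^sub>\<infinity>\<mu>\<in>self_conjugate_partitions. fps_X ^ sum_list \<mu> * b_powi (BG_rank \<mu>)) =
    qpochhammer_inf (- (b_powi 1 * fps_X)) (fps_X ^ 4) *
    qpochhammer_inf (- (b_powi (- 1) * fps_X ^ 3)) (fps_X ^ 4)"
proof -
  define y :: "nat \<Rightarrow> series" where "y a = fps_X ^ (2 * a + 1) * b_powi ((- 1) ^ a)" for a
  have "(\<Sum>\<^sub>\<infinity>\<mu>\<in>self_conjugate_partitions. fps_X ^ sum_list \<mu> * b_powi (BG_rank \<mu>)) =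
      (\<Sum>\<^sub>\<infinity>\<mu>\<in>self_conjugate_partitions. \<Prod>a\<in>nat ` (beads \<mu> \<inter> {0..}). y a)"
    by (intro infsum_cong) (simp only: sum_list_eq_sum_Fpow BG_rank_eq_sum_Fpow power_sum
        b_powi_sum y_def prod.distrib)
  also have "\<dots> = (\<Sum>\<^sub>\<infinity>A\<in>{A. finite A}. \<Prod>a\<in>A. y a)"
    by (rule infsum_reindex_bij_betw[OF bij_betw_self_conjugate_Fpow])
  also have "\<dots> = qpochhammer_inf (- (b_powi 1 * fps_X)) (fps_X ^ 4) *
      qpochhammer_inf (- (b_powi (- 1) * fps_X ^ 3)) (fps_X ^ 4)"
  proof (rule fps_eq_upto)
    fix n
    have y0: "eq_upto a (y a) 0" for a
      unfolding y_def by (rule eq_upto_X_power_mult) simp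
    \<comment> \<open>An even number of factors splits into \<open>Suc n\<close> of each parity,
      enough for both Pochhammer symbols.\<close>
    have 1: "eq_upto n (\<Sum>\<^sub>\<infinity>A\<in>{A. finite A}. \<Prod>a\<in>A. y a) (\<Prod>a<2 * Suc n. 1 + y a)"
      by (rule infsum_finite_subsets[OF y0]) simp
    have "(\<Prod>a<2 * Suc n. 1 + y a) = (\<Prod>j<Suc n. 1 - - (b_powi 1 * fps_X) * fps_X ^ (4 * j)) *
        (\<Prod>j<Suc n. 1 - - (b_powi (- 1) * fps_X ^ 3) * fps_X ^ (4 * j))"
      unfolding prod_lessThan_double
    proof (intro arg_cong2[where f = "(*)"] prod.cong refl)
      fix j
      show "1 + y (2 * j) = 1 - - (b_powi 1 * fps_X) * fps_X ^ (4 * j)"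
        by (simp add: y_def mult_ac)
      have "2 * (2 * j + 1) + 1 = 3 + 4 * j"
        by simp
      then show "1 + y (2 * j + 1) = 1 - - (b_powi (- 1) * fps_X ^ 3) * fps_X ^ (4 * j)"
        unfolding y_def by (simp only: power_add) simp
    qed
    moreover have "eq_upto n (qpochhammer_inf (- (b_powi 1 * fps_X)) (fps_X ^ 4) *
      qpochhammer_inf (- (b_powi (- 1) * fps_X ^ 3)) (fps_X ^ 4)) \<dots>"
      by (intro eq_upto_mult qpochhammer_eq_upto) simp_all
    ultimately show "eq_upto n (\<Sum>\<^sub>\<infinity>A\<in>{A. finite A}. \<Prod>a\<in>A. y a)
        (qpochhammer_inf (- (b_powi 1 * fps_X)) (fps_X ^ 4) *
        qpochhammer_inf (- (b_powi (- 1) * fps_X ^ 3)) (fps_X ^ 4))"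
      using 1 by (auto intro: eq_upto_join)
  qed
  finally show ?thesis .
qed

section \<open>Charge sums and the factorization over runners\<close>

text \<open>Used twice: the exponent is nonnegative, so \<open>nat\<close> loses nothing, and each
  degree is reached by finitely many charges only.\<close>

lemma theta_exponent_bound:
  fixes c :: int
  assumes "r < m"
  shows "\<bar>c\<bar> \<le> 2 * int m * (c * (c - 1)) + (2 * int r + 1) * c"
proof (cases "0 \<le> c")
  case True
  have "0 \<le> c * (c - 1)"
    using True by (cases "c = 0") auto
  then have "0 \<le> 2 * int m * (c * (c - 1))"
    by simp
  moreover have "0 \<le> 2 * int r * c"
    using True by simp
  ultimately show ?thesis
    using True by (simp add: distrib_right)
next
  case False
  define d where "d = - c"
  have d: "1 \<le> d" "c = - d"
    using False by (auto simp: d_def)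
  \<comment> \<open>Here 2m(d + 1) is at least 4m, while r < m keeps 2r + 1 below 2m.\<close>
  have "1 \<le> 2 * int m * (d + 1) - (2 * int r + 1)"
  proof -
    have "2 * int m * 2 \<le> 2 * int m * (d + 1)"
      using d(1) by (intro mult_left_mono) auto
    then show ?thesis
      using assms by linarith
  qed
  then have "d * 1 \<le> d * (2 * int m * (d + 1) - (2 * int r + 1))"
    using d(1) by (intro mult_left_mono) auto
  also have "\<dots> = 2 * int m * (c * (c - 1)) + (2 * int r + 1) * c"
    by (simp add: d(2) algebra_simps)
  finally show ?thesis
    using d by simp
qed

text \<open>A bilateral theta series: at charge c over the empty partition the energy is c(c - 1)/2,
  so 4m times energy plus (2r + 1) times charge is this exponent.\<close>

definition theta :: "nat \<Rightarrow> nat \<Rightarrow> series" where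
  "theta m r = (\<Sum>\<^sub>\<infinity>c. fps_X ^ nat (2 * int m * (c * (c - 1)) + (2 * int r + 1) * c) *
    b_powi ((- 1) ^ r * c))"

lemma locally_finite_theta:
  assumes "r < m"
  shows "locally_finite (\<lambda>c. fps_X ^ nat (2 * int m * (c * (c - 1)) + (2 * int r + 1) * c) *
    b_powi ((- 1) ^ r * c)) UNIV"
proof (rule locally_finite_subdegree[of _
      "\<lambda>c. nat (2 * int m * (c * (c - 1)) + (2 * int r + 1) * c)"])
  fix n
  have "\<bar>c\<bar> \<le> int n" if "nat (2 * int m * (c * (c - 1)) + (2 * int r + 1) * c) \<le> n" for c
    using theta_exponent_bound[OF assms, of c] that by linarith
  then have "{c \<in> UNIV. nat (2 * int m * (c * (c - 1)) + (2 * int r + 1) * c) \<le> n} \<subseteq> {- int n..int n}"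
    by (auto simp: abs_le_iff minus_le_iff)
  then show "finite {c \<in> UNIV. nat (2 * int m * (c * (c - 1)) + (2 * int r + 1) * c) \<le> n}"
    by (rule finite_subset) simp
qed (use eq_upto_X_power_mult in \<open>auto simp: eq_upto_def\<close>)

text \<open>The weight \<open>v\<close> is arbitrary and may vary with the runner: the constant 1
  will identify the product of the theta series, and weights that single out one runner will give
  the theorem.\<close>

lemma infsum_self_conjugate_factorization:
  fixes v :: "nat \<Rightarrow> nat multiset \<Rightarrow> series"
  assumes m: "0 < m"
  defines "u \<equiv> \<lambda>\<mu>. fps_X ^ sum_list \<mu> * b_powi (BG_rank \<mu>) *
    (\<Prod>r<m. v r (maya_hooks (runner (2 * m) r (beads \<mu>))))"
  shows "locally_finite u self_conjugate_partitions"
    and "infsum u self_conjugate_partitions =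
      (\<Prod>r<m. theta m r * (\<Sum>\<^sub>\<infinity>\<nu>\<in>partitions. fps_X ^ (4 * m * sum_list \<nu>) * v r (hooks \<nu>)))"
proof -
  \<comment> \<open>By \<open>sum_list_self_conjugate\<close>, \<open>e r S\<close> is what runner
    \<open>r\<close> adds to the size; \<open>\<theta> r c\<close> is its part that depends on the
    charge.\<close>
  define e where "e r S = 4 * int m * energy S + (2 * int r + 1) * charge S" for r S
  define \<theta> where "\<theta> r c = 2 * int m * (c * (c - 1)) + (2 * int r + 1) * c" for r c
  define wt where "wt r S = fps_X ^ nat (e r S) * b_powi ((- 1) ^ r * charge S) * v r (maya_hooks S)"
    for r S
  have e: "e r (shift c (beads \<nu>)) = int (4 * m * sum_list \<nu>) + \<theta> r c"
    if "\<nu> \<in> partitions" for r c \<nu>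
  proof -
    have "4 * int m * energy (shift c (beads \<nu>)) = 2 * int m * (2 * energy (shift c (beads \<nu>)))"
      by simp
    also have "\<dots> = 2 * int m * (2 * int (sum_list \<nu>) + c * (c - 1))"
      using that by (simp only: energy_shift maya_beads charge_beads energy_beads) simp
    finally show ?thesis
      using that by (simp add: e_def \<theta>_def charge_shift maya_beads charge_beads algebra_simps)
  qed
  have \<theta>: "0 \<le> \<theta> r c" if "r < m" for r c
    using theta_exponent_bound[OF that, of c] by (simp add: \<theta>_def)
  have e_nonneg: "0 \<le> e r S" if "r < m" "maya S" for r S
  proof -
    from that(2) obtain c \<nu> where "\<nu> \<in> partitions" "S = shift c (beads \<nu>)"
      by (rule maya_eq_shift_beads)
    then show ?thesis
      using e \<theta>[OF that(1)] by simp
  qed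
  have lfs: "locally_finite (wt r) (Collect maya) \<and> infsum (wt r) (Collect maya) =
      theta m r * (\<Sum>\<^sub>\<infinity>\<nu>\<in>partitions. fps_X ^ (4 * m * sum_list \<nu>) * v r (hooks \<nu>))"
    if "r < m" for r
  proof -
    let ?f = "\<lambda>c. fps_X ^ nat (\<theta> r c) * b_powi ((- 1) ^ r * c)"
    let ?g = "\<lambda>\<nu>. fps_X ^ (4 * m * sum_list \<nu>) * v r (hooks \<nu>)"
    let ?h = "\<lambda>(c, \<nu>). shift c (beads \<nu>)"
    have f: "locally_finite ?f UNIV"
      using locally_finite_theta[OF that] by (simp add: \<theta>_def)
    have g: "locally_finite ?g partitions"
      using m by (intro locally_finite_X_power_partitions) simp
    have eq: "wt r (?h p) = (case p of (c, \<nu>) \<Rightarrow> ?f c * ?g \<nu>)" if p: "p \<in> UNIV \<times> partitions" for p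
    proof -
      obtain c \<nu> where [simp]: "p = (c, \<nu>)"
        by force
      have \<nu>: "\<nu> \<in> partitions"
        using p by simp
      have "nat (e r (shift c (beads \<nu>))) = 4 * m * sum_list \<nu> + nat (\<theta> r c)"
        unfolding e[OF \<nu>] using \<theta>[OF \<open>r < m\<close>] by (simp only: nat_add_distrib of_nat_0_le_iff nat_int)
      then show ?thesis
        using \<nu> by (simp add: wt_def power_add charge_shift maya_beads charge_beads maya_hooks_shift
            hooks_eq_maya_hooks mult_ac)
    qed
    have "locally_finite (\<lambda>p. wt r (?h p)) (UNIV \<times> partitions)"
      by (rule locally_finite_cong[OF eq[symmetric] infsum_mult_Times(1)[OF f g]])
    then have "locally_finite (wt r) (Collect maya)"
      by (simp only: locally_finite_reindex[OF bij_betw_shift_beads])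
    moreover have "infsum (wt r) (Collect maya) = (\<Sum>\<^sub>\<infinity>p\<in>UNIV \<times> partitions. wt r (?h p))"
      by (rule infsum_reindex_bij_betw[OF bij_betw_shift_beads, symmetric])
    moreover have "\<dots> = (\<Sum>\<^sub>\<infinity>(c, \<nu>)\<in>UNIV \<times> partitions. ?f c * ?g \<nu>)"
      by (rule infsum_cong) (rule eq)
    moreover have "\<dots> = infsum ?f UNIV * infsum ?g partitions"
      by (rule infsum_mult_Times(2)[OF f g])
    moreover have "infsum ?f UNIV = theta m r"
      by (simp add: theta_def \<theta>_def)
    ultimately show ?thesis
      by (simp only: simp_thms)
  qed
  define X where "X \<mu> = (\<lambda>r\<in>{..<m}. runner (2 * m) r (beads \<mu>))" for \<mu>
  have X: "bij_betw X self_conjugate_partitions (PiE {..<m} (\<lambda>_. Collect maya))"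
    using bij_betw_self_conjugate_runners[OF m] unfolding X_def[abs_def] .
  have eq: "(\<Prod>r<m. wt r (X \<mu> r)) = u \<mu>" if \<mu>: "\<mu> \<in> self_conjugate_partitions" for \<mu>
  proof -
    let ?T = "\<lambda>r. runner (2 * m) r (beads \<mu>)"
    have maya: "maya (?T r)" if "r < m" for r
      using maya_iff_runners[of "2 * m" "beads \<mu>"] maya_beads m that by simp
    have "int (sum_list \<mu>) = (\<Sum>r<m. e r (?T r))"
      using sum_list_self_conjugate[OF \<mu> m] by (simp add: e_def)
    also have "\<dots> = int (\<Sum>r<m. nat (e r (?T r)))"
      using e_nonneg maya by simp
    finally have size: "sum_list \<mu> = (\<Sum>r<m. nat (e r (?T r)))"
      by (simp only: of_nat_eq_iff)
    have "(\<Prod>r<m. wt r (X \<mu> r)) = (\<Prod>r<m. wt r (?T r))"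
      by (rule prod.cong) (auto simp: X_def)
    also have "\<dots> = u \<mu>"
      unfolding wt_def u_def size BG_rank_self_conjugate[OF \<mu> m] power_sum b_powi_sum
      by (simp only: prod.distrib)
    finally show ?thesis .
  qed
  have lf: "locally_finite (wt r) (Collect maya)" if "r < m" for r
    using lfs[OF that] by (rule conjunct1)
  have PiE: "locally_finite (\<lambda>x. \<Prod>r<m. wt r (x r)) (PiE {..<m} (\<lambda>_. Collect maya))"
    "(\<Sum>\<^sub>\<infinity>x\<in>PiE {..<m} (\<lambda>_. Collect maya). \<Prod>r<m. wt r (x r)) = (\<Prod>r<m. infsum (wt r) (Collect maya))"
    by (rule prod_infsum_PiE, simp_all add: lf)+
  have "locally_finite (\<lambda>\<mu>. \<Prod>r<m. wt r (X \<mu> r)) self_conjugate_partitions"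
    using PiE(1) by (simp only: locally_finite_reindex[OF X, of "\<lambda>x. \<Prod>r<m. wt r (x r)"])
  then show "locally_finite u self_conjugate_partitions"
    by (rule locally_finite_cong[rotated]) (rule eq)
  have "infsum u self_conjugate_partitions = (\<Sum>\<^sub>\<infinity>\<mu>\<in>self_conjugate_partitions. \<Prod>r<m. wt r (X \<mu> r))"
    by (rule infsum_cong) (simp add: eq)
  also have "\<dots> = (\<Prod>r<m. infsum (wt r) (Collect maya))"
    unfolding PiE(2)[symmetric] by (rule infsum_reindex_bij_betw[OF X, of "\<lambda>x. \<Prod>r<m. wt r (x r)"])
  also have "\<dots> = (\<Prod>r<m. theta m r *
      (\<Sum>\<^sub>\<infinity>\<nu>\<in>partitions. fps_X ^ (4 * m * sum_list \<nu>) * v r (hooks \<nu>)))"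
    using lfs by (intro prod.cong) auto
  finally show "infsum u self_conjugate_partitions = \<dots>" .
qed

lemma prod_theta:
  assumes m: "0 < m"
  shows "(\<Prod>r<m. theta m r) = qpochhammer_inf (fps_X ^ (4 * m)) (fps_X ^ (4 * m)) ^ m *
    qpochhammer_inf (- (b_powi 1 * fps_X)) (fps_X ^ 4) *
    qpochhammer_inf (- (b_powi (- 1) * fps_X ^ 3)) (fps_X ^ 4)"
proof -
  let ?P = "\<Sum>\<^sub>\<infinity>\<nu>\<in>partitions. fps_X ^ (4 * m * sum_list \<nu>) :: series"
  let ?E = "qpochhammer_inf (fps_X ^ (4 * m)) (fps_X ^ (4 * m)) :: series"
  have PE: "?P * ?E = 1"
    using m by (intro infsum_partitions_times_qpochhammer) simp
  have "(\<Sum>\<^sub>\<infinity>\<mu>\<in>self_conjugate_partitions. fps_X ^ sum_list \<mu> * b_powi (BG_rank \<mu>)) =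
      (\<Prod>r<m. theta m r) * ?P ^ m"
    using infsum_self_conjugate_factorization(2)[OF m, of "\<lambda>_ _. 1"] by (simp add: prod.distrib)
  then have 1: "(\<Prod>r<m. theta m r) * ?P ^ m =
      qpochhammer_inf (- (b_powi 1 * fps_X)) (fps_X ^ 4) *
      qpochhammer_inf (- (b_powi (- 1) * fps_X ^ 3)) (fps_X ^ 4)"
    by (simp only: infsum_self_conjugate_eq_qpochhammer)
  \<comment> \<open>Euler's product inverts \<open>?P\<close>, so the m partition series can be
    cancelled.\<close>
  have 2: "?P ^ m * ?E ^ m = 1"
    by (simp add: PE flip: power_mult_distrib)
  have "(\<Prod>r<m. theta m r) = (\<Prod>r<m. theta m r) * (?P ^ m * ?E ^ m)"
    by (simp only: 2 mult_1_right)
  also have "\<dots> = (\<Prod>r<m. theta m r) * ?P ^ m * ?E ^ m"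
    by (simp only: mult.assoc)
  finally show ?thesis
    unfolding 1 by (simp only: mult_ac)
qed

section \<open>Complex coefficients and substitution\<close>

definition fps_of_complex :: "complex \<Rightarrow> series" where
  "fps_of_complex c = fps_const (coeff_of_complex c)"

lemma coeff_of_complex_add: "coeff_of_complex (c + d) = coeff_of_complex c + coeff_of_complex d"
  by (simp add: coeff_of_complex_def add: fls_plus_const)

lemma coeff_of_complex_0 [simp]: "coeff_of_complex 0 = 0"
  by (simp add: coeff_of_complex_def)

lemma coeff_of_complex_mult: "coeff_of_complex (c * d) = coeff_of_complex c * coeff_of_complex d"
  by (simp add: coeff_of_complex_def add: mult.commute)

lemma coeff_of_complex_sum: "coeff_of_complex (sum f A) = (\<Sum>a\<in>A. coeff_of_complex (f a))"
  by (induction A rule: infinite_finite_induct) (simp_all add: coeff_of_complex_add)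

lemma fps_of_complex_0 [simp]: "fps_of_complex 0 = 0"
  by (simp add: fps_of_complex_def)

lemma fps_of_complex_1 [simp]: "fps_of_complex 1 = 1"
  by (simp add: fps_of_complex_def coeff_of_complex_def one_pCons[symmetric])

lemma fps_of_complex_add: "fps_of_complex (c + d) = fps_of_complex c + fps_of_complex d"
  by (simp add: fps_of_complex_def coeff_of_complex_add)

lemma fps_of_complex_mult: "fps_of_complex (c * d) = fps_of_complex c * fps_of_complex d"
  by (simp add: fps_of_complex_def coeff_of_complex_mult)

lemma fps_of_complex_sum: "fps_of_complex (sum f A) = (\<Sum>a\<in>A. fps_of_complex (f a))"
  by (induction A rule: infinite_finite_induct) (simp_all add: fps_of_complex_add)

lemma fps_of_complex_prod: "fps_of_complex (prod f A) = (\<Prod>a\<in>A. fps_of_complex (f a))"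
  by (induction A rule: infinite_finite_induct) (simp_all add: fps_of_complex_mult)

text \<open>Coefficient n of a composition involves the outer coefficients up to n only, and
  \<open>z ^ k\<close> has order at least k. Both sides therefore truncate to the same finite set,
  on which substitution respects sums and products.\<close>

lemma subst_series_infsum_partitions:
  assumes z: "fps_nth z 0 = 0"
  shows "subst_series (\<Sum>\<^sub>\<infinity>\<nu>\<in>partitions. fps_X ^ sum_list \<nu> * fps_const (a \<nu>)) z =
    (\<Sum>\<^sub>\<infinity>\<nu>\<in>partitions. z ^ sum_list \<nu> * fps_of_complex (a \<nu>))"
proof (rule fps_eq_upto)
  fix n
  define F where "F = {\<nu> \<in> partitions. sum_list \<nu> \<le> n}"
  have F: "finite F" "F \<subseteq> partitions"
    using finite_partitions_le by (auto simp: F_def)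
  let ?f = "\<lambda>\<nu>. fps_X ^ sum_list \<nu> * fps_const (a \<nu>)"
  let ?g = "\<lambda>\<nu>. z ^ sum_list \<nu> * fps_of_complex (a \<nu>)"
  have lf: "locally_finite ?f partitions"
    using locally_finite_X_power_partitions[of 1 "\<lambda>\<nu>. fps_const (a \<nu>)"] by simp
  have z0: "eq_upto k (?g \<nu>) 0" if "k < sum_list \<nu>" for k \<nu>
  proof -
    have "eq_upto k (z ^ sum_list \<nu>) 0"
      using startsby_zero_power_prefix[OF z] that by (auto simp: eq_upto_def)
    from eq_upto_mult[OF this eq_upto_refl] show ?thesis
      by simp
  qed
  have lg: "locally_finite ?g partitions"
    by (rule locally_finite_partitions[of 1]) (use z0 in \<open>auto simp: eq_upto_def\<close>)
  have 1: "eq_upto n (infsum ?f partitions) (sum ?f F)"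
    by (rule infsum_eq_upto[OF lf F]) (auto simp: F_def intro!: eq_upto_X_power_mult)
  have 2: "eq_upto n (infsum ?g partitions) (sum ?g F)"
    by (rule infsum_eq_upto[OF lg F]) (auto simp: F_def intro!: z0)
  have "eq_upto n (subst_series (infsum ?f partitions) z) (subst_series (sum ?f F) z)"
    using 1 by (auto simp: eq_upto_def subst_series_def fps_compose_nth)
  also have "subst_series (sum ?f F) z = sum ?g F"
  proof -
    have "Abs_fps (\<lambda>n. coeff_of_complex (fps_nth (sum ?f F) n)) =
        (\<Sum>\<nu>\<in>F. fps_X ^ sum_list \<nu> * fps_of_complex (a \<nu>))"
      by (auto simp: fps_eq_iff fps_sum_nth coeff_of_complex_sum fps_of_complex_def
          fps_X_power_mult_nth intro!: sum.cong)
    then show ?thesis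
      using z by (simp add: subst_series_def fps_compose_sum_distrib fps_compose_mult_distrib
          fps_X_power_compose fps_of_complex_def)
  qed
  finally show "eq_upto n (subst_series (infsum ?f partitions) z) (infsum ?g partitions)"
    using 2 by (rule eq_upto_join)
qed

lemma size_sum_multiset: "size (sum f A :: 'b multiset) = (\<Sum>a\<in>A. size (f a))"
  by (induction A rule: infinite_finite_induct) auto

lemma prod_mset_image_sum:
  "prod_mset (image_mset g (sum f A)) = (\<Prod>a\<in>A. prod_mset (image_mset g (f a)))"
  by (induction A rule: infinite_finite_induct) auto

lemma sum_mset_image_sum:
  "sum_mset (image_mset g (sum f A)) = (\<Sum>a\<in>A. sum_mset (image_mset g (f a)))"
  by (induction A rule: infinite_finite_induct) auto

lemma prod_mset_power2: "prod_mset (image_mset (\<lambda>h. (g h)\<^sup>2) M) = (prod_mset (image_mset g M))\<^sup>2"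
  by (induction M) (simp_all add: power_mult_distrib)

theorem theorem1p2:
  fixes t :: nat and \<rho>\<^sub>1 \<rho>\<^sub>2 :: "nat \<Rightarrow> complex"
  assumes "0 < t" and "even t"
  shows "(\<Sum>\<^sub>\<infinity>\<mu>\<in>self_conjugate_partitions.
            var_q ^ sum_list \<mu> * var_x ^ size (hooks_div t \<mu>) * b_powi (BG_rank \<mu>)
            * fps_const (coeff_of_complex
                ((\<Prod>h\<in>#hooks_div t \<mu>. \<rho>\<^sub>1 h) * (\<Sum>h\<in>#hooks_div t \<mu>. \<rho>\<^sub>2 h))))
         = of_nat t
           * subst_series (f_series t \<rho>\<^sub>1) (var_x\<^sup>2 * var_q ^ (2 * t)) ^ (t div 2 - 1)
           * subst_series (g_series t \<rho>\<^sub>1 \<rho>\<^sub>2) (var_x\<^sup>2 * var_q ^ (2 * t))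
           * qpochhammer_inf (var_q ^ (2 * t)) (var_q ^ (2 * t)) ^ (t div 2)
           * qpochhammer_inf (- (b_powi 1 * var_q)) (var_q ^ 4)
           * qpochhammer_inf (- (b_powi (- 1) * var_q ^ 3)) (var_q ^ 4)"
proof -
  obtain m where t: "t = 2 * m"
    using assms(2) by (rule evenE)
  have m: "0 < m"
    using assms(1) t by simp
  define P where "P M = (\<Prod>h\<in>#M. (\<rho>\<^sub>1 (t * h))\<^sup>2)" for M
  define s where "s M = (\<Sum>h\<in>#M. \<rho>\<^sub>2 (t * h))" for M
  define W where "W M = var_x ^ (2 * size M) * fps_of_complex (P M)" for M
  \<comment> \<open>Runner \<open>r\<close> is the marked one: it alone carries the additive
    statistic \<open>s\<close>, which makes \<open>u r\<close> a product over runners.\<close>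
  define v where "v r r' M = W M * (if r' = r then fps_of_complex (s M) else 1)" for r r' :: nat and M
  define M where "M \<mu> r = maya_hooks (runner (2 * m) r (beads \<mu>))" for \<mu> r
  define u where "u r \<mu> = fps_X ^ sum_list \<mu> * b_powi (BG_rank \<mu>) * (\<Prod>r'<m. v r r' (M \<mu> r'))" for r \<mu>
  define z where "z = var_x\<^sup>2 * var_q ^ (2 * t)"
  define F where "F = subst_series (f_series t \<rho>\<^sub>1) z"
  define G where "G = subst_series (g_series t \<rho>\<^sub>1 \<rho>\<^sub>2) z"
  have z0: "fps_nth z 0 = 0"
    using assms(1) by (simp add: z_def var_q_def)
  \<comment> \<open>With k the size of \<nu>, which is also its number of hooks, the power of x here
    is the one in \<open>W\<close>.\<close>
  have z_power: "z ^ k = fps_X ^ (4 * m * k) * var_x ^ (2 * k)" for k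
    by (simp add: z_def var_q_def t power_mult_distrib mult_ac flip: power_mult)
  have F: "F = (\<Sum>\<^sub>\<infinity>\<nu>\<in>partitions. fps_X ^ (4 * m * sum_list \<nu>) * W (hooks \<nu>))"
    unfolding F_def f_series_def subst_series_infsum_partitions[OF z0] z_power
    by (simp only: W_def P_def size_hooks mult.assoc)
  have G: "G = (\<Sum>\<^sub>\<infinity>\<nu>\<in>partitions. fps_X ^ (4 * m * sum_list \<nu>) *
      (W (hooks \<nu>) * fps_of_complex (s (hooks \<nu>))))"
    unfolding G_def g_series_def subst_series_infsum_partitions[OF z0] z_power
    by (simp only: W_def P_def s_def size_hooks mult.assoc fps_of_complex_mult)
  have u: "locally_finite (u r) self_conjugate_partitions"
    "infsum (u r) self_conjugate_partitions = (\<Prod>r'<m. theta m r') * (F ^ (m - 1) * G)" if "r < m" for r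
  proof -
    show "locally_finite (u r) self_conjugate_partitions"
      using infsum_self_conjugate_factorization(1)[OF m, of "v r"] by (simp add: u_def[abs_def] M_def)
    have "(\<Sum>\<^sub>\<infinity>\<nu>\<in>partitions. fps_X ^ (4 * m * sum_list \<nu>) * v r r' (hooks \<nu>)) =
        (if r' = r then G else F)" for r'
      by (simp add: v_def F G)
    then have "infsum (u r) self_conjugate_partitions =
        (\<Prod>r'<m. theta m r' * (if r' = r then G else F))"
      using infsum_self_conjugate_factorization(2)[OF m, of "v r"] by (simp add: u_def[abs_def] M_def)
    also have "\<dots> = (\<Prod>r'<m. theta m r') * (\<Prod>r'<m. if r' = r then G else F)"
      by (rule prod.distrib)
    also have "(\<Prod>r'<m. if r' = r then G else F) = G * (\<Prod>r'\<in>{..<m} - {r}. F)"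
      using that by (subst prod.remove[of _ r]) auto
    also have "\<dots> = F ^ (m - 1) * G"
      using that by (simp add: card_Diff_subset)
    finally show "infsum (u r) self_conjugate_partitions =
        (\<Prod>r'<m. theta m r') * (F ^ (m - 1) * G)" .
  qed
  have summand: "var_q ^ sum_list \<mu> * var_x ^ size (hooks_div t \<mu>) * b_powi (BG_rank \<mu>)
      * fps_const (coeff_of_complex
          ((\<Prod>h\<in>#hooks_div t \<mu>. \<rho>\<^sub>1 h) * (\<Sum>h\<in>#hooks_div t \<mu>. \<rho>\<^sub>2 h))) = (\<Sum>r<m. 2 * u r \<mu>)"
    if \<mu>: "\<mu> \<in> self_conjugate_partitions" for \<mu>
  proof -
    have hooks: "hooks_div t \<mu> = (\<Sum>r<m. image_mset ((*) t) (M \<mu> r + M \<mu> r))"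
      unfolding t M_def by (rule hooks_div_self_conjugate[OF \<mu> m])
    have size: "size (hooks_div t \<mu>) = (\<Sum>r<m. 2 * size (M \<mu> r))"
      by (simp add: hooks size_sum_multiset mult_2)
    have P: "P N = (\<Prod>h\<in>#N. \<rho>\<^sub>1 (t * h)) * (\<Prod>h\<in>#N. \<rho>\<^sub>1 (t * h))" for N
      unfolding P_def prod_mset_power2 by (rule power2_eq_square)
    have prod: "(\<Prod>h\<in>#hooks_div t \<mu>. \<rho>\<^sub>1 h) = (\<Prod>r<m. P (M \<mu> r))"
      unfolding hooks prod_mset_image_sum
      by (simp add: P multiset.map_comp o_def)
    have sum: "(\<Sum>h\<in>#hooks_div t \<mu>. \<rho>\<^sub>2 h) = (\<Sum>r<m. 2 * s (M \<mu> r))"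
      unfolding hooks sum_mset_image_sum
      by (simp add: s_def multiset.map_comp o_def)
    have two: "fps_of_complex 2 = 2"
      using fps_of_complex_add[of 1 1] by simp
    have "(\<Prod>r'<m. v r r' (M \<mu> r')) = var_x ^ size (hooks_div t \<mu>) *
        fps_of_complex (\<Prod>h\<in>#hooks_div t \<mu>. \<rho>\<^sub>1 h) * fps_of_complex (s (M \<mu> r))" if "r < m" for r
      using that unfolding v_def W_def size prod
      by (simp add: prod.distrib fps_of_complex_prod power_sum)
    then have "(\<Sum>r<m. 2 * u r \<mu>) = (\<Sum>r<m. fps_X ^ sum_list \<mu> * b_powi (BG_rank \<mu>) *
        var_x ^ size (hooks_div t \<mu>) * fps_of_complex (\<Prod>h\<in>#hooks_div t \<mu>. \<rho>\<^sub>1 h) *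
        fps_of_complex (2 * s (M \<mu> r)))"
      by (intro sum.cong) (simp_all add: u_def fps_of_complex_mult two mult_ac)
    also have "\<dots> = fps_X ^ sum_list \<mu> * b_powi (BG_rank \<mu>) *
        var_x ^ size (hooks_div t \<mu>) * fps_of_complex (\<Prod>h\<in>#hooks_div t \<mu>. \<rho>\<^sub>1 h) *
        fps_of_complex (\<Sum>h\<in>#hooks_div t \<mu>. \<rho>\<^sub>2 h)"
      by (simp only: sum fps_of_complex_sum sum_distrib_left)
    finally show ?thesis
      by (simp only: fps_of_complex_def[symmetric] fps_of_complex_mult var_q_def mult_ac)
  qed
  have "(\<Sum>\<^sub>\<infinity>\<mu>\<in>self_conjugate_partitions.
      var_q ^ sum_list \<mu> * var_x ^ size (hooks_div t \<mu>) * b_powi (BG_rank \<mu>)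
      * fps_const (coeff_of_complex
          ((\<Prod>h\<in>#hooks_div t \<mu>. \<rho>\<^sub>1 h) * (\<Sum>h\<in>#hooks_div t \<mu>. \<rho>\<^sub>2 h)))) =
      (\<Sum>\<^sub>\<infinity>\<mu>\<in>self_conjugate_partitions. \<Sum>r<m. 2 * u r \<mu>)"
    by (rule infsum_cong) (rule summand)
  also have "\<dots> = (\<Sum>r<m. \<Sum>\<^sub>\<infinity>\<mu>\<in>self_conjugate_partitions. 2 * u r \<mu>)"
    by (rule infsum_sum_swap) (use u(1) in \<open>auto intro: infsum_cmult_fps(1)\<close>)
  also have "\<dots> = (\<Sum>r<m. 2 * ((\<Prod>r'<m. theta m r') * (F ^ (m - 1) * G)))"
    by (rule sum.cong) (use u in \<open>auto simp: infsum_cmult_fps(2)\<close>)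
  \<comment> \<open>The m choices of the marked runner and the factor 2 from the doubled hooks
    combine to 2m = t.\<close>
  also have "\<dots> = of_nat t * ((\<Prod>r'<m. theta m r') * (F ^ (m - 1) * G))"
    by (simp add: t)
  also have "\<dots> = of_nat t * F ^ (t div 2 - 1) * G
      * qpochhammer_inf (var_q ^ (2 * t)) (var_q ^ (2 * t)) ^ (t div 2)
      * qpochhammer_inf (- (b_powi 1 * var_q)) (var_q ^ 4)
      * qpochhammer_inf (- (b_powi (- 1) * var_q ^ 3)) (var_q ^ 4)"
  proof -
    have "4 * m = 2 * t" "t div 2 = m"
      by (simp_all add: t)
    then show ?thesis
      unfolding prod_theta[OF m] var_q_def by (simp only: mult_ac)
  qed
  finally show ?thesis
    unfolding F_def G_def z_def .
qed

end
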